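(* Let $\mathcal{G}_h$ be a rectangular grid of $\Omega$ and let $V_{h0}^{\rm R}=V_{h0}^{\rm R}(\mathcal{G}_h)$ be the reduced rectangular Morley element space with $H^2_0$-type boundary condition. Then for all $u_h, v_h\in V_{h0}^{\rm R}$, $$\sum_{K\in\mathcal{G}_h}\int_K \Delta u_h\,\Delta v_h \;=\; \sum_{K\in\mathcal{G}_h}\int_K \nabla^2 u_h:\nabla^2 v_h .$$
   Context: $\Omega\subset\mathbb{R}^2$ is a simply-connected (not necessarily convex) polygon that can be subdivided into rectangles with sides parallel to the coordinate axes, and $\mathcal{G}_h$ is a (conforming) subdivision of $\Omega$ into such rectangles (cells). $\mathcal{N}_h^i,\mathcal{N}_h^b$ denote the interior and boundary vertices and $\mathcal{E}_h^i,\mathcal{E}_h^b$ the interior and boundary edges of the grid; $\mathbf{n}_e$ is a fixed unit normal of the edge $e$, and $⨍_e$ (written below as $\frac{1}{|e|}\int_e$) is the mean value over $e$. $\nabla^2$ is the Hessian and $:$ the Frobenius inner product. The space $V_{h0}^{\rm R}(\mathcal{G}_h)$ consists of all $w_h\in L^2(\Omega)$ such that: $w_h|_K\in P_2(K)$ (polynomials of total degree at most $2$) for every cell $K$; $w_h$ is continuous at every $a\in\mathcal{N}_h^i$; $\frac{1}{|e|}\int_e\partial_{\mathbf{n}_e}w_h\,ds$ is continuous across every $e\in\mathcal{E}_h^i$; $w_h(a)=0$ for every $a\in\mathcal{N}_h^b$; and $\frac{1}{|e|}\int_e\partial_{\mathbf{n}_e}w_h\,ds=0$ for every $e\in\mathcal{E}_h^b$.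 *)

theory Defs
  imports "HOL-Analysis.Analysis"
begin

type_synonym plane = "real \<times> real"

text \<open>
  A polygon is a nonempty bounded open connected set whose boundary consists of finitely many
  segments. The condition \<open>\<Omega> = interior (closure \<Omega>)\<close> excludes slits and punctures.
\<close>

definition polygonal_domain :: "plane set \<Rightarrow> bool" where
  "polygonal_domain \<Omega> \<longleftrightarrow>
     open \<Omega> \<and> bounded \<Omega> \<and> connected \<Omega> \<and> \<Omega> \<noteq> {} \<and> \<Omega> = interior (closure \<Omega>) \<and>
     (\<exists>S. finite S \<and> frontier \<Omega> = (\<Union>(p, q)\<in>S. closed_segment p q))"

text \<open>
  The cells are closed nondegenerate axis-parallel rectangles. Conformity: two cells meet in a
  common face, i.e. for distinct cells in the empty set, a common vertex or a common full edge.
\<close>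

definition rectangular_grid :: "plane set \<Rightarrow> plane set set \<Rightarrow> bool" where
  "rectangular_grid \<Omega> \<G> \<longleftrightarrow>
     finite \<G> \<and>
     (\<forall>K\<in>\<G>. \<exists>p q. box p q \<noteq> {} \<and> K = cbox p q) \<and>
     (\<forall>K\<in>\<G>. \<forall>K'\<in>\<G>. K \<inter> K' face_of K \<and> K \<inter> K' face_of K') \<and>
     \<Union>\<G> = closure \<Omega>"

definition grid_vertices :: "plane set set \<Rightarrow> plane set" where
  "grid_vertices \<G> = {a. \<exists>K\<in>\<G>. a extreme_point_of K}"

definition grid_edges :: "plane set set \<Rightarrow> plane set set" where
  "grid_edges \<G> = {e. \<exists>K\<in>\<G>. e edge_of K}"

definition interior_vertices :: "plane set \<Rightarrow> plane set set \<Rightarrow> plane set" where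
  "interior_vertices \<Omega> \<G> = grid_vertices \<G> \<inter> \<Omega>"

definition boundary_vertices :: "plane set \<Rightarrow> plane set set \<Rightarrow> plane set" where
  "boundary_vertices \<Omega> \<G> = grid_vertices \<G> \<inter> frontier \<Omega>"

text \<open>
  The end points of an interior edge may lie on the boundary of the domain, hence the relative
  interior.
\<close>

definition interior_edges :: "plane set \<Rightarrow> plane set set \<Rightarrow> plane set set" where
  "interior_edges \<Omega> \<G> = {e \<in> grid_edges \<G>. rel_interior e \<subseteq> \<Omega>}"

definition boundary_edges :: "plane set \<Rightarrow> plane set set \<Rightarrow> plane set set" where
  "boundary_edges \<Omega> \<G> = {e \<in> grid_edges \<G>. e \<subseteq> frontier \<Omega>}"

definition unit_normals :: "plane set set \<Rightarrow> (plane set \<Rightarrow> plane) \<Rightarrow> bool" where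
  "unit_normals \<G> n \<longleftrightarrow>
     (\<forall>e\<in>grid_edges \<G>. norm (n e) = 1 \<and> (\<forall>x\<in>e. \<forall>y\<in>e. n e \<bullet> (x - y) = 0))"

definition dir_deriv :: "plane \<Rightarrow> (plane \<Rightarrow> real) \<Rightarrow> plane \<Rightarrow> real" where
  "dir_deriv d f x = frechet_derivative f (at x) d"

definition laplacian :: "(plane \<Rightarrow> real) \<Rightarrow> plane \<Rightarrow> real" where
  "laplacian f x = (\<Sum>b\<in>Basis. dir_deriv b (dir_deriv b f) x)"

definition hessian_inner :: "(plane \<Rightarrow> real) \<Rightarrow> (plane \<Rightarrow> real) \<Rightarrow> plane \<Rightarrow> real" where
  "hessian_inner f g x =
     (\<Sum>b\<in>Basis. \<Sum>c\<in>Basis. dir_deriv b (dir_deriv c f) x * dir_deriv b (dir_deriv c g) x)"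

text \<open>
  The mean value \<open>1/|e| \<integral>\<^sub>e f ds\<close> over a segment \<open>e\<close> with end points \<open>p\<close> and \<open>q\<close>, where
  \<open>ds = dist p q dt\<close> in the parametrisation \<open>linepath p q\<close>. The end points are determined by \<open>e\<close>
  up to their order, which does not affect the value.
\<close>

definition edge_mean :: "plane set \<Rightarrow> (plane \<Rightarrow> real) \<Rightarrow> real" where
  "edge_mean e f =
     (let (p, q) = (SOME (p, q). e = closed_segment p q)
      in 1 / dist p q * integral {0..1} (\<lambda>t. f (linepath p q t) * dist p q))"

definition P2 :: "(plane \<Rightarrow> real) set" where
  "P2 = {p. \<exists>c0 c1 c2 c3 c4 c5. \<forall>x y.
           p (x, y) = c0 + c1 * x + c2 * y + c3 * x\<^sup>2 + c4 * x * y + c5 * y\<^sup>2}"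

text \<open>
  Members of the finite element space are \<open>L\<^sup>2\<close> functions, determined only up to null sets. Their
  point values, traces and derivatives on a cell \<open>K\<close> are those of the polynomial \<open>cell_poly w K\<close>
  that agrees with \<open>w\<close> almost everywhere on \<open>K\<close>.
\<close>

definition cell_poly :: "(plane \<Rightarrow> real) \<Rightarrow> plane set \<Rightarrow> plane \<Rightarrow> real" where
  "cell_poly w K = (THE p. p \<in> P2 \<and> (AE x in lebesgue_on K. w x = p x))"

lemma quadratic_zero_on_interval:
  fixes a b \<alpha> \<beta> \<gamma> :: real
  assumes "a < b" and z: "\<And>x. a < x \<Longrightarrow> x < b \<Longrightarrow> \<alpha> + \<beta> * x + \<gamma> * x\<^sup>2 = 0"
  shows "\<alpha> = 0 \<and> \<beta> = 0 \<and> \<gamma> = 0"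
proof -
  define m h where "m = (a + b) / 2" and "h = (b - a) / 4"
  have h: "h > 0" "a < m - h" "m - h < m" "m < m + h" "m + h < b"
    using \<open>a < b\<close> by (auto simp: m_def h_def field_simps)
  have e: "\<alpha> + \<beta> * (m - h) + \<gamma> * (m - h)\<^sup>2 = 0" "\<alpha> + \<beta> * m + \<gamma> * m\<^sup>2 = 0"
    "\<alpha> + \<beta> * (m + h) + \<gamma> * (m + h)\<^sup>2 = 0"
    using h by (auto intro!: z)
  have "2 * \<gamma> * h\<^sup>2 = 0"
  proof -
    have "2 * \<gamma> * h\<^sup>2 = (\<alpha> + \<beta> * (m - h) + \<gamma> * (m - h)\<^sup>2) + (\<alpha> + \<beta> * (m + h) + \<gamma> * (m + h)\<^sup>2)
        - 2 * (\<alpha> + \<beta> * m + \<gamma> * m\<^sup>2)"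
      by (simp add: power2_eq_square algebra_simps)
    then show ?thesis using e by simp
  qed
  then have g: "\<gamma> = 0" using h by simp
  have "\<alpha> + \<beta> * m = 0" using e(2) g by simp
  moreover have "\<alpha> + (\<beta> * m + \<beta> * h) = 0" using e(3) g by (simp add: distrib_left)
  ultimately have "\<beta> * h = 0" by linarith
  then have "\<beta> = 0" using h by simp
  with g e show ?thesis by simp
qed

lemma P2_unique:
  assumes "p \<in> P2" "q \<in> P2" "box a b \<noteq> {}"
    and pq: "AE x in lebesgue_on (cbox a b). p x = q x"
  shows "p = q"
proof -
  obtain c0 c1 c2 c3 c4 c5 where
    p: "\<And>x y. p (x, y) = c0 + c1 * x + c2 * y + c3 * x\<^sup>2 + c4 * x * y + c5 * y\<^sup>2"
    using \<open>p \<in> P2\<close> unfolding P2_def by blast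
  obtain d0 d1 d2 d3 d4 d5 where
    q: "\<And>x y. q (x, y) = d0 + d1 * x + d2 * y + d3 * x\<^sup>2 + d4 * x * y + d5 * y\<^sup>2"
    using \<open>q \<in> P2\<close> unfolding P2_def by blast
  have p': "p = (\<lambda>z. c0 + c1 * fst z + c2 * snd z + c3 * (fst z)\<^sup>2 + c4 * fst z * snd z + c5 * (snd z)\<^sup>2)"
    and q': "q = (\<lambda>z. d0 + d1 * fst z + d2 * snd z + d3 * (fst z)\<^sup>2 + d4 * fst z * snd z + d5 * (snd z)\<^sup>2)"
    using p q by (auto simp: fun_eq_iff)
  let ?S = "box a b \<inter> {x. p x \<noteq> q x}"
  have "continuous_on UNIV p" "continuous_on UNIV q"
    unfolding p' q' by (intro continuous_intros)+
  then have "open ?S"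
    by (intro open_Int open_box open_Collect_neq)
  have "AE x in lebesgue. x \<in> cbox a b \<longrightarrow> p x = q x"
    using pq by (subst (asm) AE_restrict_space_iff) auto
  then have "negligible {x. \<not> (x \<in> cbox a b \<longrightarrow> p x = q x)}"
    by (simp add: completion.AE_iff_null_sets negligible_iff_null_sets)
  then have "negligible ?S"
    by (rule negligible_subset) (use box_subset_cbox in auto)
  with \<open>open ?S\<close> have "?S = {}"
    using open_not_negligible by blast
  obtain a1 a2 b1 b2 where ab: "a = (a1, a2)" "b = (b1, b2)" by (cases a, cases b)
  have lt: "a1 < b1" "a2 < b2"
    using \<open>box a b \<noteq> {}\<close> by (auto simp: ab box_ne_empty Basis_prod_def)
  have z: "(c0 - d0 + (c2 - d2) * y + (c5 - d5) * y\<^sup>2) + (c1 - d1 + (c4 - d4) * y) * x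
      + (c3 - d3) * x\<^sup>2 = 0" if "a1 < x" "x < b1" "a2 < y" "y < b2" for x y
  proof -
    have "(x, y) \<in> box a b" using that by (auto simp: ab mem_box Basis_prod_def)
    then have "p (x, y) = q (x, y)" using \<open>?S = {}\<close> by auto
    then show ?thesis unfolding p q by (simp add: algebra_simps)
  qed
  have z': "c0 - d0 + (c2 - d2) * y + (c5 - d5) * y\<^sup>2 = 0 \<and> c1 - d1 + (c4 - d4) * y = 0 \<and> c3 - d3 = 0"
    if "a2 < y" "y < b2" for y
    by (rule quadratic_zero_on_interval[OF lt(1)]) (use z that in blast)
  have 1: "c0 - d0 = 0 \<and> c2 - d2 = 0 \<and> c5 - d5 = 0"
    by (rule quadratic_zero_on_interval[OF lt(2)]) (use z' in blast)
  have 2: "c1 - d1 = 0 \<and> c4 - d4 = 0 \<and> (0::real) = 0"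
    by (rule quadratic_zero_on_interval[OF lt(2)]) (use z' in auto)
  have 3: "c3 = d3"
    using z'[of "(a2 + b2) / 2"] lt by simp
  from 1 2 3 show ?thesis unfolding p' q' by simp
qed

lemma cell_poly_eqI:
  assumes "p \<in> P2" "box a b \<noteq> {}" "AE x in lebesgue_on (cbox a b). w x = p x"
  shows "cell_poly w (cbox a b) = p"
  unfolding cell_poly_def
proof (rule the_equality)
  fix q assume q: "q \<in> P2 \<and> (AE x in lebesgue_on (cbox a b). w x = q x)"
  have "AE x in lebesgue_on (cbox a b). q x = p x"
    using assms(3) conjunct2[OF q] by eventually_elim simp
  then show "q = p" using P2_unique q assms by blast
qed (use assms in auto)

text \<open>
  By conformity a grid vertex \<open>a \<in> K\<close> is a vertex of \<open>K\<close>. Continuity means that the traces from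
  all adjacent cells coincide.
\<close>

definition V_h0_R :: "plane set \<Rightarrow> plane set set \<Rightarrow> (plane set \<Rightarrow> plane) \<Rightarrow> (plane \<Rightarrow> real) set" where
  "V_h0_R \<Omega> \<G> n = {w.
     w \<in> borel_measurable (lebesgue_on \<Omega>) \<and> integrable (lebesgue_on \<Omega>) (\<lambda>x. (w x)\<^sup>2) \<and>
     (\<forall>K\<in>\<G>. \<exists>p\<in>P2. AE x in lebesgue_on K. w x = p x) \<and>
     (\<forall>a\<in>interior_vertices \<Omega> \<G>. \<forall>K\<in>\<G>. \<forall>K'\<in>\<G>. a \<in> K \<and> a \<in> K' \<longrightarrow>
        cell_poly w K a = cell_poly w K' a) \<and>
     (\<forall>e\<in>interior_edges \<Omega> \<G>. \<forall>K\<in>\<G>. \<forall>K'\<in>\<G>. e edge_of K \<and> e edge_of K' \<longrightarrow>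
        edge_mean e (dir_deriv (n e) (cell_poly w K)) = edge_mean e (dir_deriv (n e) (cell_poly w K'))) \<and>
     (\<forall>a\<in>boundary_vertices \<Omega> \<G>. \<forall>K\<in>\<G>. a \<in> K \<longrightarrow> cell_poly w K a = 0) \<and>
     (\<forall>e\<in>boundary_edges \<Omega> \<G>. \<forall>K\<in>\<G>. e edge_of K \<longrightarrow>
        edge_mean e (dir_deriv (n e) (cell_poly w K)) = 0)}"

end

theory Submission
  imports Defs
begin

text \<open>
  On a cell \<open>K\<close> the second derivatives are constant, and the difference of the two integrals is
  \<open>|K| (u\<^sub>x\<^sub>x v\<^sub>y\<^sub>y + u\<^sub>y\<^sub>y v\<^sub>x\<^sub>x - 2 u\<^sub>x\<^sub>y v\<^sub>x\<^sub>y)\<close>. This is a difference of two Jacobian integrals, of the pair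
  \<open>(u\<^sub>x, v\<^sub>y)\<close> and of the pair \<open>(u\<^sub>y, v\<^sub>x)\<close>. For affine \<open>g\<close> and \<open>h\<close> such an integral can be written in
  terms of the values at the midpoints of the four edges of \<open>K\<close> as
  \<open>(g\<^sub>R - g\<^sub>L) (h\<^sub>T - h\<^sub>B) - (g\<^sub>T - g\<^sub>B) (h\<^sub>R - h\<^sub>L)\<close>, called \<open>wedge K g h\<close> below.

  The degrees of freedom make the gradient of a finite element function single-valued at edge
  midpoints and zero at midpoints of boundary edges: the normal component by definition of the
  space, the tangential one because for quadratic polynomials it is a difference quotient of vertex
  values. Each component is affine on every cell, so its edge values are balanced:
  \<open>g\<^sub>L + g\<^sub>R = g\<^sub>B + g\<^sub>T\<close>. It remains to prove the purely discrete statement \<open>sum_wedge_eq_0\<close>: the cell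
  terms \<open>wedge K g h\<close> of balanced edge functions, with \<open>h\<close> zero on the boundary, sum to zero.

  If the edge values of \<open>g\<close> are sums of two numbers attached to the end points of the edge, then
  \<open>wedge K g h\<close> is a discrete integral of \<open>h\<close> along the boundary of \<open>K\<close>; the contributions of interior
  edges cancel in pairs and those of boundary edges vanish (\<open>sum_wedge_potential\<close>). Balance provides
  such a potential on each cell, unique up to adding a constant with alternating signs to the four
  corners. Patching the local potentials together is a problem about the topology of \<open>\<Omega>\<close>, and this
  is where simple connectedness enters. If all values are integers, the interpolated local
  potentials, corrected by a checkerboard sign, differ by integers on common edges, hence
  \<open>exp (2 \<pi> \<i> \<rho>)\<close> is a well-defined continuous function on \<open>\<Omega>\<close> and its continuous logarithm provides
  the missing constants (\<open>integer_cocycle_trivial\<close>, \<open>integer_potential_exists\<close>). The checkerboard sign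
  is obtained in the same way. Real edge functions follow by simultaneous approximation with
  integer ones.
\<close>

section \<open>Integer cocycles on simply connected domains\<close>

text \<open>
  The integer differences make \<open>exp (2 \<pi> \<i> \<rho>\<^sub>K)\<close> a single nonvanishing continuous function on
  \<open>\<Omega>\<close>. It has a continuous logarithm, and on each cell that logarithm, divided by \<open>2 \<pi> \<i>\<close>, differs
  from \<open>\<rho>\<^sub>K\<close> by a continuous integer-valued function, hence by a constant \<open>k\<^sub>K\<close>. Agreement is claimed
  only at points of \<open>\<Omega>\<close>: the closure of a simply connected domain can touch itself, and going
  around such a point may change the branch.
\<close>

lemma integer_cocycle_trivial:
  fixes \<Omega> :: "'a::real_normed_vector set" and \<G> :: "'a set set" and \<rho> :: "'a set \<Rightarrow> 'a \<Rightarrow> real"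
  assumes "open \<Omega>" "simply_connected \<Omega>" "finite \<G>" "\<Omega> \<subseteq> \<Union>\<G>"
    and clo: "\<And>K. K \<in> \<G> \<Longrightarrow> closed K"
    and con: "\<And>K. K \<in> \<G> \<Longrightarrow> connected (K \<inter> \<Omega>)"
    and cont: "\<And>K. K \<in> \<G> \<Longrightarrow> continuous_on K (\<rho> K)"
    and int: "\<And>K K' z. K \<in> \<G> \<Longrightarrow> K' \<in> \<G> \<Longrightarrow> z \<in> K \<Longrightarrow> z \<in> K' \<Longrightarrow> \<rho> K z - \<rho> K' z \<in> \<int>"
  obtains k :: "'a set \<Rightarrow> int" where
    "\<And>K K' z. K \<in> \<G> \<Longrightarrow> K' \<in> \<G> \<Longrightarrow> z \<in> K \<Longrightarrow> z \<in> K' \<Longrightarrow> z \<in> \<Omega> \<Longrightarrow>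
       of_int (k K) + \<rho> K z = of_int (k K') + \<rho> K' z"
proof -
  define e where "e = (\<lambda>t::real. exp (2 * of_real pi * \<i> * of_real t))"
  define C where "C = (\<lambda>z. SOME K. K \<in> \<G> \<and> z \<in> K)"
  define f where "f = (\<lambda>z. e (\<rho> (C z) z))"
  have e_int: "e s = e t" if "s - t \<in> \<int>" for s t
  proof -
    from that obtain n :: int where "s = t + of_int n"
      by (metis Ints_cases diff_add_cancel add.commute)
    then have "2 * of_real pi * \<i> * of_real s
        = 2 * of_real pi * \<i> * of_real t + of_real (of_int (2 * n) * pi) * \<i>"
      by (simp add: algebra_simps)
    then show ?thesis unfolding e_def exp_eq by blast
  qed
  have f_cell: "f z = e (\<rho> K z)" if "K \<in> \<G>" "z \<in> K" for K z
  proof -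
    have "C z \<in> \<G> \<and> z \<in> C z" unfolding C_def by (rule someI[of _ K]) (use that in blast)
    then show ?thesis unfolding f_def using that by (intro e_int int) auto
  qed
  have "continuous_on (\<Union>K\<in>\<G>. K) f"
  proof (rule continuous_on_closed_Union)
    fix K assume K: "K \<in> \<G>"
    show "closed K" by (rule clo[OF K])
    have "continuous_on K (\<lambda>z. e (\<rho> K z))"
      unfolding e_def by (intro continuous_intros cont K)
    then show "continuous_on K f"
      by (rule continuous_on_eq) (simp add: f_cell[OF K])
  qed fact
  then have "continuous_on \<Omega> f" by (rule continuous_on_subset) (use assms in simp)
  then obtain g where g: "continuous_on \<Omega> g" "\<And>z. z \<in> \<Omega> \<Longrightarrow> f z = exp (g z)"
    by (rule continuous_logarithm_on_simply_connected)
      (use assms in \<open>auto simp: f_def e_def open_imp_locally_path_connected\<close>)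
  define \<theta> where "\<theta> = (\<lambda>z. Im (g z) / (2 * pi))"
  have \<theta>_int: "\<theta> z - \<rho> K z \<in> \<int>" if "K \<in> \<G>" "z \<in> K" "z \<in> \<Omega>" for K z
  proof -
    have "exp (g z) = exp (2 * of_real pi * \<i> * of_real (\<rho> K z))"
      using g(2)[OF that(3)] f_cell[OF that(1,2)] unfolding e_def by simp
    then obtain n :: int where "g z = 2 * of_real pi * \<i> * of_real (\<rho> K z) + of_real (of_int (2 * n) * pi) * \<i>"
      unfolding exp_eq by blast
    then have "Im (g z) = 2 * pi * \<rho> K z + 2 * of_int n * pi" by simp
    then have "\<theta> z - \<rho> K z = of_int n"
      unfolding \<theta>_def by (simp add: field_simps)
    then show ?thesis by simp
  qed
  have "\<exists>k::int. \<forall>z\<in>K \<inter> \<Omega>. \<theta> z - \<rho> K z = of_int k" if K: "K \<in> \<G>" for K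
  proof -
    have "(\<lambda>z. \<theta> z - \<rho> K z) constant_on (K \<inter> \<Omega>)"
    proof (rule continuous_discrete_range_constant[OF con[OF K]])
      show "continuous_on (K \<inter> \<Omega>) (\<lambda>z. \<theta> z - \<rho> K z)"
        unfolding \<theta>_def
        by (intro continuous_intros continuous_on_subset[OF g(1)] continuous_on_subset[OF cont[OF K]]) auto
    next
      fix x assume x: "x \<in> K \<inter> \<Omega>"
      have "1 \<le> norm ((\<theta> y - \<rho> K y) - (\<theta> x - \<rho> K x))"
        if "y \<in> K \<inter> \<Omega>" "\<theta> y - \<rho> K y \<noteq> \<theta> x - \<rho> K x" for y
      proof -
        have "(\<theta> y - \<rho> K y) - (\<theta> x - \<rho> K x) \<in> \<int>"
          using that(1) x K by (intro Ints_diff \<theta>_int) auto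
        then show ?thesis using that(2) Ints_nonzero_abs_ge1 by force
      qed
      then show "\<exists>e>0. \<forall>y. y \<in> K \<inter> \<Omega> \<and> \<theta> y - \<rho> K y \<noteq> \<theta> x - \<rho> K x \<longrightarrow>
          e \<le> norm ((\<theta> y - \<rho> K y) - (\<theta> x - \<rho> K x))"
        by (intro exI[of _ 1]) auto
    qed
    then obtain c where c: "\<forall>z\<in>K \<inter> \<Omega>. \<theta> z - \<rho> K z = c" unfolding constant_on_def by blast
    show ?thesis
    proof (cases "K \<inter> \<Omega> = {}")
      case False
      then obtain z where "z \<in> K \<inter> \<Omega>" by blast
      then show ?thesis using c \<theta>_int[OF K] by (metis IntE Ints_cases)
    qed auto
  qed
  then obtain k :: "'a set \<Rightarrow> int" where k: "\<And>K z. K \<in> \<G> \<Longrightarrow> z \<in> K \<inter> \<Omega> \<Longrightarrow> \<theta> z - \<rho> K z = of_int (k K)"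
    by metis
  show ?thesis
  proof (rule that)
    fix K K' z assume "K \<in> \<G>" "K' \<in> \<G>" "z \<in> K" "z \<in> K'" "z \<in> \<Omega>"
    then show "of_int (k K) + \<rho> K z = of_int (k K') + \<rho> K' z"
      using k[of K z] k[of K' z] by auto
  qed
qed

section \<open>Rectangular grids\<close>

definition xl :: "plane set \<Rightarrow> real" where "xl K = fst (interval_lowerbound K)"
definition xr :: "plane set \<Rightarrow> real" where "xr K = fst (interval_upperbound K)"
definition yb :: "plane set \<Rightarrow> real" where "yb K = snd (interval_lowerbound K)"
definition yt :: "plane set \<Rightarrow> real" where "yt K = snd (interval_upperbound K)"

text \<open>
  An edge is represented by its midpoint. The midpoint of an edge of a cell determines the edge, so
  an edge function is simply a function on the plane that is evaluated at midpoints only, and two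
  neighbouring cells automatically read the same value on their common edge.
\<close>

definition midL :: "plane set \<Rightarrow> plane" where "midL K = (xl K, (yb K + yt K) / 2)"
definition midR :: "plane set \<Rightarrow> plane" where "midR K = (xr K, (yb K + yt K) / 2)"
definition midB :: "plane set \<Rightarrow> plane" where "midB K = ((xl K + xr K) / 2, yb K)"
definition midT :: "plane set \<Rightarrow> plane" where "midT K = ((xl K + xr K) / 2, yt K)"

definition right_nbr :: "plane set \<Rightarrow> plane set \<Rightarrow> bool" where
  "right_nbr K K' \<longleftrightarrow> xl K' = xr K \<and> yb K' = yb K \<and> yt K' = yt K"
definition upper_nbr :: "plane set \<Rightarrow> plane set \<Rightarrow> bool" where
  "upper_nbr K K' \<longleftrightarrow> yb K' = yt K \<and> xl K' = xl K \<and> xr K' = xr K"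

text \<open>
  Coordinates that identify the cell with the unit square.
\<close>

definition cell_fst :: "plane set \<Rightarrow> plane \<Rightarrow> real" where
  "cell_fst K z = (fst z - xl K) / (xr K - xl K)"
definition cell_snd :: "plane set \<Rightarrow> plane \<Rightarrow> real" where
  "cell_snd K z = (snd z - yb K) / (yt K - yb K)"

text \<open>
  An interval of positive length contains, as its only nonempty faces, itself and its end points.
  This is the one-dimensional content of conformity.
\<close>

lemma intervals_meeting_in_faces:
  fixes a b c d t :: real
  assumes "a < b" "c < d" "t \<in> {a..b}" "t \<in> {c..d}"
    and "({a..b} \<inter> {c..d}) face_of {a..b}" "({a..b} \<inter> {c..d}) face_of {c..d}"
  shows "a = c \<and> b = d \<or> b = c \<or> d = a"
proof (rule ccontr)
  assume n: "\<not> ?thesis"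
  define \<alpha> \<beta> where "\<alpha> = max a c" and "\<beta> = min b d"
  have "\<alpha> < \<beta>" using n assms unfolding \<alpha>_def \<beta>_def by auto
  then have s: "(\<alpha> + \<beta>) / 2 \<in> {a..b} \<inter> {c..d}" "(\<alpha> + \<beta>) / 2 \<in> open_segment a b"
      "(\<alpha> + \<beta>) / 2 \<in> open_segment c d"
    using assms(1,2) by (auto simp: open_segment_eq_real_ivl \<alpha>_def \<beta>_def max_def min_def split: if_splits)
  have "a \<in> {a..b} \<inter> {c..d} \<and> b \<in> {a..b} \<inter> {c..d}"
    by (rule face_ofD[OF assms(5) s(2)]) (use s assms(1) in auto)
  moreover have "c \<in> {a..b} \<inter> {c..d} \<and> d \<in> {a..b} \<inter> {c..d}"
    by (rule face_ofD[OF assms(6) s(3)]) (use s assms(2) in auto)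
  ultimately show False using n by auto
qed

locale rect_grid =
  fixes \<Omega> :: "plane set" and \<G> :: "plane set set"
  assumes domain: "polygonal_domain \<Omega>" and grid: "rectangular_grid \<Omega> \<G>"
begin

lemma open_\<Omega>: "open \<Omega>" and interior_closure_\<Omega>: "interior (closure \<Omega>) = \<Omega>"
  using domain unfolding polygonal_domain_def by auto

lemma finite_\<G>: "finite \<G>" and Union_\<G>: "\<Union>\<G> = closure \<Omega>"
  using grid unfolding rectangular_grid_def by auto

lemma cell_bounds: "xl K < xr K" "yb K < yt K"
  and cell_cbox: "K = cbox (xl K, yb K) (xr K, yt K)" if "K \<in> \<G>" for K
proof -
  have "\<forall>K\<in>\<G>. \<exists>p q. box p q \<noteq> {} \<and> K = cbox p q"
    using grid unfolding rectangular_grid_def by (elim conjE)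
  from bspec[OF this that] obtain p q where pq: "box p q \<noteq> {}" "K = cbox p q"
    by (elim exE conjE)
  have "\<forall>i\<in>Basis. p \<bullet> i < q \<bullet> i" using pq(1) by (simp add: box_ne_empty)
  then have "interval_lowerbound K = p" "interval_upperbound K = q" "fst p < fst q" "snd p < snd q"
    unfolding pq(2) by (auto intro!: interval_lowerbound interval_upperbound less_imp_le
        simp: Basis_prod_def inner_prod_def)
  then show "xl K < xr K" "yb K < yt K" "K = cbox (xl K, yb K) (xr K, yt K)"
    by (simp_all add: xl_def xr_def yb_def yt_def pq)
qed

lemma mem_cell: "K \<in> \<G> \<Longrightarrow> z \<in> K \<longleftrightarrow> xl K \<le> fst z \<and> fst z \<le> xr K \<and> yb K \<le> snd z \<and> snd z \<le> yt K"
  using arg_cong[OF cell_cbox, of K "\<lambda>S. z \<in> S"] by (cases z) auto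

lemma cell_eq_Times: "K \<in> \<G> \<Longrightarrow> K = {xl K..xr K} \<times> {yb K..yt K}"
  by (rule set_eqI) (auto simp: mem_cell)

lemma cell_eqI:
  assumes "K \<in> \<G>" "K' \<in> \<G>" "xl K = xl K'" "xr K = xr K'" "yb K = yb K'" "yt K = yt K'"
  shows "K = K'"
  by (rule set_eqI) (simp add: mem_cell assms)

lemma cells_meet:
  assumes K: "K \<in> \<G>" "K' \<in> \<G>" and z: "z \<in> K" "z \<in> K'"
  shows "xl K = xl K' \<and> xr K = xr K' \<or> xr K = xl K' \<or> xr K' = xl K" (is ?X)
    and "yb K = yb K' \<and> yt K = yt K' \<or> yt K = yb K' \<or> yt K' = yb K" (is ?Y)
proof -
  have f: "K \<inter> K' face_of K" "K \<inter> K' face_of K'"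
    using grid K unfolding rectangular_grid_def by (metis (no_types))+
  let ?I = "{xl K..xr K} \<inter> {xl K'..xr K'}" and ?J = "{yb K..yt K} \<inter> {yb K'..yt K'}"
  have KK: "K \<inter> K' = ?I \<times> ?J"
    using K by (intro set_eqI) (auto simp: mem_cell)
  have ne: "fst z \<in> ?I" "snd z \<in> ?J" using z K by (auto simp: mem_cell)
  have "(?I \<times> ?J) face_of ({xl K..xr K} \<times> {yb K..yt K})"
    "(?I \<times> ?J) face_of ({xl K'..xr K'} \<times> {yb K'..yt K'})"
    using f arg_cong[OF cell_eq_Times[OF K(1)], of "\<lambda>S. ?I \<times> ?J face_of S"]
      arg_cong[OF cell_eq_Times[OF K(2)], of "\<lambda>S. ?I \<times> ?J face_of S"]
    unfolding KK by blast+
  then have F: "?I face_of {xl K..xr K}" "?J face_of {yb K..yt K}"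
    "?I face_of {xl K'..xr K'}" "?J face_of {yb K'..yt K'}"
    using ne unfolding face_of_Times_eq by blast+
  show ?X
    by (rule intervals_meeting_in_faces[OF cell_bounds(1)[OF K(1)] cell_bounds(1)[OF K(2)] _ _ F(1,3)])
      (use ne in auto)
  show ?Y
    by (rule intervals_meeting_in_faces[OF cell_bounds(2)[OF K(1)] cell_bounds(2)[OF K(2)] _ _ F(2,4)])
      (use ne in auto)
qed

text \<open>
  Conformity in the form in which it is used: distinct cells that share a point are neighbours
  across a full edge, with matching coordinates along that edge, or the point is a corner of both.
\<close>

lemma cells_meet_cases:
  assumes K: "K \<in> \<G>" "K' \<in> \<G>" and z: "z \<in> K" "z \<in> K'"
  obtains "K = K'"
  | "right_nbr K K'" "cell_fst K z = 1" "cell_fst K' z = 0" "cell_snd K z = cell_snd K' z"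
  | "right_nbr K' K" "cell_fst K z = 0" "cell_fst K' z = 1" "cell_snd K z = cell_snd K' z"
  | "upper_nbr K K'" "cell_snd K z = 1" "cell_snd K' z = 0" "cell_fst K z = cell_fst K' z"
  | "upper_nbr K' K" "cell_snd K z = 0" "cell_snd K' z = 1" "cell_fst K z = cell_fst K' z"
  | "cell_fst K z \<in> {0, 1}" "cell_fst K' z \<in> {0, 1}" "cell_snd K z \<in> {0, 1}" "cell_snd K' z \<in> {0, 1}"
proof -
  note b = cell_bounds[OF K(1)] cell_bounds[OF K(2)]
  have zz: "xl K \<le> fst z" "fst z \<le> xr K" "yb K \<le> snd z" "snd z \<le> yt K"
    "xl K' \<le> fst z" "fst z \<le> xr K'" "yb K' \<le> snd z" "snd z \<le> yt K'"
    using z K by (auto simp: mem_cell)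
  have one: "(xr K - xl K) / (xr K - xl K) = 1" "(yt K - yb K) / (yt K - yb K) = 1"
    "(xr K' - xl K') / (xr K' - xl K') = 1" "(yt K' - yb K') / (yt K' - yb K') = 1"
    using b by auto
  have X: "xl K = xl K' \<and> xr K = xr K' \<and> cell_fst K z = cell_fst K' z
      \<or> xl K' = xr K \<and> cell_fst K z = 1 \<and> cell_fst K' z = 0
      \<or> xl K = xr K' \<and> cell_fst K z = 0 \<and> cell_fst K' z = 1"
    using cells_meet(1)[OF K z]
  proof (elim disjE)
    assume h: "xr K = xl K'"
    then have "fst z = xr K" using zz by simp
    then have "cell_fst K z = 1" "cell_fst K' z = 0" using h one unfolding cell_fst_def by auto
    with h show ?thesis by auto
  next
    assume h: "xr K' = xl K"
    then have "fst z = xr K'" using zz by simp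
    then have "cell_fst K' z = 1" "cell_fst K z = 0" using h one unfolding cell_fst_def by auto
    with h show ?thesis by auto
  qed (simp add: cell_fst_def)
  have Y: "yb K = yb K' \<and> yt K = yt K' \<and> cell_snd K z = cell_snd K' z
      \<or> yb K' = yt K \<and> cell_snd K z = 1 \<and> cell_snd K' z = 0
      \<or> yb K = yt K' \<and> cell_snd K z = 0 \<and> cell_snd K' z = 1"
    using cells_meet(2)[OF K z]
  proof (elim disjE)
    assume h: "yt K = yb K'"
    then have "snd z = yt K" using zz by simp
    then have "cell_snd K z = 1" "cell_snd K' z = 0" using h one unfolding cell_snd_def by auto
    with h show ?thesis by auto
  next
    assume h: "yt K' = yb K"
    then have "snd z = yt K'" using zz by simp
    then have "cell_snd K' z = 1" "cell_snd K z = 0" using h one unfolding cell_snd_def by auto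
    with h show ?thesis by auto
  qed (simp add: cell_snd_def)
  show thesis
    using X Y
  proof (elim disjE conjE)
    assume "xl K = xl K'" "xr K = xr K'" "yb K = yb K'" "yt K = yt K'"
    then show thesis using that(1) cell_eqI[OF K] by blast
  qed (auto intro: that simp: right_nbr_def upper_nbr_def)
qed

lemma right_nbr_unique:
  assumes "K \<in> \<G>" "K' \<in> \<G>" "K'' \<in> \<G>" "right_nbr K K'" "right_nbr K K''"
  shows "K' = K''"
proof -
  have "(xr K, yb K) \<in> K'" "(xr K, yb K) \<in> K''"
    using assms cell_bounds[of K'] cell_bounds[of K''] by (auto simp: mem_cell right_nbr_def)
  then show ?thesis
    using assms cells_meet(1)[of K' K''] cell_bounds[of K'] cell_bounds[of K'']
    by (intro cell_eqI) (auto simp: right_nbr_def)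
qed

lemma left_nbr_unique:
  assumes "K \<in> \<G>" "K' \<in> \<G>" "K'' \<in> \<G>" "right_nbr K' K" "right_nbr K'' K"
  shows "K' = K''"
proof -
  have "(xl K, yb K) \<in> K'" "(xl K, yb K) \<in> K''"
    using assms cell_bounds[of K'] cell_bounds[of K''] by (auto simp: mem_cell right_nbr_def)
  then show ?thesis
    using assms cells_meet(1)[of K' K''] cell_bounds[of K'] cell_bounds[of K'']
    by (intro cell_eqI) (auto simp: right_nbr_def)
qed

lemma upper_nbr_unique:
  assumes "K \<in> \<G>" "K' \<in> \<G>" "K'' \<in> \<G>" "upper_nbr K K'" "upper_nbr K K''"
  shows "K' = K''"
proof -
  have "(xl K, yt K) \<in> K'" "(xl K, yt K) \<in> K''"
    using assms cell_bounds[of K'] cell_bounds[of K''] by (auto simp: mem_cell upper_nbr_def)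
  then show ?thesis
    using assms cells_meet(2)[of K' K''] cell_bounds[of K'] cell_bounds[of K'']
    by (intro cell_eqI) (auto simp: upper_nbr_def)
qed

lemma lower_nbr_unique:
  assumes "K \<in> \<G>" "K' \<in> \<G>" "K'' \<in> \<G>" "upper_nbr K' K" "upper_nbr K'' K"
  shows "K' = K''"
proof -
  have "(xl K, yb K) \<in> K'" "(xl K, yb K) \<in> K''"
    using assms cell_bounds[of K'] cell_bounds[of K''] by (auto simp: mem_cell upper_nbr_def)
  then show ?thesis
    using assms cells_meet(2)[of K' K''] cell_bounds[of K'] cell_bounds[of K'']
    by (intro cell_eqI) (auto simp: upper_nbr_def)
qed

lemma interior_cell_subset: "K \<in> \<G> \<Longrightarrow> interior K \<subseteq> \<Omega>"
  using interior_mono[of K "closure \<Omega>"] Union_\<G> interior_closure_\<Omega> by auto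

lemma closed_cell: "K \<in> \<G> \<Longrightarrow> closed K"
  by (rule iffD2[OF arg_cong[OF cell_cbox, of _ closed] closed_cbox])

lemma connected_cell_Int: "K \<in> \<G> \<Longrightarrow> connected (K \<inter> \<Omega>)"
proof -
  assume K: "K \<in> \<G>"
  have c: "convex K" using arg_cong[OF cell_cbox[OF K], of convex] by simp
  have "box (xl K, yb K) (xr K, yt K) \<noteq> {}"
    using cell_bounds[OF K] by (auto simp: box_ne_empty Basis_prod_def)
  then have ne: "interior K \<noteq> {}" using arg_cong[OF cell_cbox[OF K], of interior] by simp
  show ?thesis
  proof (rule connected_intermediate_closure)
    show "connected (interior K)" using c by (intro convex_connected convex_interior)
    show "interior K \<subseteq> K \<inter> \<Omega>" using interior_cell_subset[OF K] interior_subset by blast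
    show "K \<inter> \<Omega> \<subseteq> closure (interior K)"
      using convex_closure_interior[OF c ne] closure_subset by blast
  qed
qed

text \<open>
  The two cells cover a neighbourhood of the open edge, which therefore lies in the interior of the
  closure of \<open>\<Omega>\<close>, that is in \<open>\<Omega>\<close>: no slit can run along the edge.
\<close>

lemma right_nbr_open_edge:
  assumes K: "K \<in> \<G>" "K' \<in> \<G>" and n: "right_nbr K K'" and y: "yb K < y" "y < yt K"
  shows "(xr K, y) \<in> \<Omega>"
proof -
  let ?B = "box (xl K, yb K) (xr K', yt K)"
  have "?B \<subseteq> K \<union> K'" using K n by (auto simp: mem_cell right_nbr_def mem_box Basis_prod_def)
  then have "?B \<subseteq> closure \<Omega>" using K Union_\<G> by blast
  then have "?B \<subseteq> \<Omega>" using interior_maximal[OF _ open_box] interior_closure_\<Omega> by metis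
  moreover have "(xr K, y) \<in> ?B"
    using y n cell_bounds[OF K(1)] cell_bounds[OF K(2)]
    by (auto simp: right_nbr_def mem_box Basis_prod_def)
  ultimately show ?thesis by blast
qed

lemma upper_nbr_open_edge:
  assumes K: "K \<in> \<G>" "K' \<in> \<G>" and n: "upper_nbr K K'" and x: "xl K < x" "x < xr K"
  shows "(x, yt K) \<in> \<Omega>"
proof -
  let ?B = "box (xl K, yb K) (xr K, yt K')"
  have "?B \<subseteq> K \<union> K'" using K n by (auto simp: mem_cell upper_nbr_def mem_box Basis_prod_def)
  then have "?B \<subseteq> closure \<Omega>" using K Union_\<G> by blast
  then have "?B \<subseteq> \<Omega>" using interior_maximal[OF _ open_box] interior_closure_\<Omega> by metis
  moreover have "(x, yt K) \<in> ?B"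
    using x n cell_bounds[OF K(1)] cell_bounds[OF K(2)]
    by (auto simp: upper_nbr_def mem_box Basis_prod_def)
  ultimately show ?thesis by blast
qed

end

lemma closed_segment_axis:
  fixes a b x y :: real
  assumes "a \<le> b"
  shows "closed_segment (x, a) (x, b) = {x} \<times> {a..b}" "closed_segment (a, y) (b, y) = {a..b} \<times> {y}"
proof -
  have "closed_segment (x, a) (x, b) = {x} \<times> closed_segment a b"
    "closed_segment (a, y) (b, y) = closed_segment a b \<times> {y}"
    by (auto simp: in_segment algebra_simps)
  then show "closed_segment (x, a) (x, b) = {x} \<times> {a..b}" "closed_segment (a, y) (b, y) = {a..b} \<times> {y}"
    by (simp_all add: closed_segment_eq_real_ivl1 assms)
qed

lemma aff_dim_closed_segment:
  fixes a b :: "'a::euclidean_space"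
  shows "a \<noteq> b \<Longrightarrow> aff_dim (closed_segment a b) = 1"
  by (simp add: segment_convex_hull aff_dim_convex_hull)

lemma endpoint_face_of_interval:
  fixes a b x :: real
  assumes "a \<le> b" "x = a \<or> x = b"
  shows "{x} face_of {a..b}"
  using assms extreme_point_of_segment[of x a b]
  by (simp add: face_of_singleton closed_segment_eq_real_ivl1)

context rect_grid
begin

lemma sides_edge_of:
  assumes K: "K \<in> \<G>"
  shows "closed_segment (xl K, yb K) (xl K, yt K) edge_of K"
    and "closed_segment (xr K, yb K) (xr K, yt K) edge_of K"
    and "closed_segment (xl K, yb K) (xr K, yb K) edge_of K"
    and "closed_segment (xl K, yt K) (xr K, yt K) edge_of K"
proof -
  have le: "xl K \<le> xr K" "yb K \<le> yt K" using cell_bounds[OF K] by auto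
  note f = iffD2[OF arg_cong[OF cell_eq_Times[OF K], of "\<lambda>S. F face_of S" for F]]
  have V: "closed_segment (x, yb K) (x, yt K) face_of K" if "x = xl K \<or> x = xr K" for x
    unfolding closed_segment_axis(1)[OF le(2)]
    by (rule f) (use endpoint_face_of_interval[OF le(1) that] in
        \<open>simp add: face_of_Times_eq face_of_refl\<close>)
  have H: "closed_segment (xl K, y) (xr K, y) face_of K" if "y = yb K \<or> y = yt K" for y
    unfolding closed_segment_axis(2)[OF le(1)]
    by (rule f) (use endpoint_face_of_interval[OF le(2) that] in
        \<open>simp add: face_of_Times_eq face_of_refl\<close>)
  show "closed_segment (xl K, yb K) (xl K, yt K) edge_of K"
    "closed_segment (xr K, yb K) (xr K, yt K) edge_of K"
    "closed_segment (xl K, yb K) (xr K, yb K) edge_of K"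
    "closed_segment (xl K, yt K) (xr K, yt K) edge_of K"
    unfolding edge_of_def using cell_bounds[OF K] V H by (simp_all add: aff_dim_closed_segment)
qed

lemma cell_across_side:
  assumes K: "K \<in> \<G>" "K' \<in> \<G>" "K' \<noteq> K" and z: "z \<in> K" "z \<in> K'"
  shows "fst z = xr K \<Longrightarrow> yb K < snd z \<Longrightarrow> snd z < yt K \<Longrightarrow> right_nbr K K'"
    and "fst z = xl K \<Longrightarrow> yb K < snd z \<Longrightarrow> snd z < yt K \<Longrightarrow> right_nbr K' K"
    and "snd z = yt K \<Longrightarrow> xl K < fst z \<Longrightarrow> fst z < xr K \<Longrightarrow> upper_nbr K K'"
    and "snd z = yb K \<Longrightarrow> xl K < fst z \<Longrightarrow> fst z < xr K \<Longrightarrow> upper_nbr K' K"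
proof -
  note b = cell_bounds[OF K(1)]
  have inner: "yb K < snd z \<Longrightarrow> snd z < yt K \<Longrightarrow> cell_snd K z \<noteq> 0 \<and> cell_snd K z \<noteq> 1"
    "xl K < fst z \<Longrightarrow> fst z < xr K \<Longrightarrow> cell_fst K z \<noteq> 0 \<and> cell_fst K z \<noteq> 1"
    unfolding cell_fst_def cell_snd_def using b by auto
  have ends: "fst z = xr K \<Longrightarrow> cell_fst K z = 1" "fst z = xl K \<Longrightarrow> cell_fst K z = 0"
    "snd z = yt K \<Longrightarrow> cell_snd K z = 1" "snd z = yb K \<Longrightarrow> cell_snd K z = 0"
    unfolding cell_fst_def cell_snd_def using b by auto
  show "fst z = xr K \<Longrightarrow> yb K < snd z \<Longrightarrow> snd z < yt K \<Longrightarrow> right_nbr K K'"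
    by (rule cells_meet_cases[OF K(1,2) z]) (use K(3) inner ends in auto)
  show "fst z = xl K \<Longrightarrow> yb K < snd z \<Longrightarrow> snd z < yt K \<Longrightarrow> right_nbr K' K"
    by (rule cells_meet_cases[OF K(1,2) z]) (use K(3) inner ends in auto)
  show "snd z = yt K \<Longrightarrow> xl K < fst z \<Longrightarrow> fst z < xr K \<Longrightarrow> upper_nbr K K'"
    by (rule cells_meet_cases[OF K(1,2) z]) (use K(3) inner ends in auto)
  show "snd z = yb K \<Longrightarrow> xl K < fst z \<Longrightarrow> fst z < xr K \<Longrightarrow> upper_nbr K' K"
    by (rule cells_meet_cases[OF K(1,2) z]) (use K(3) inner ends in auto)
qed

lemma interior_cell:
  assumes "K \<in> \<G>"
  shows "z \<in> interior K \<longleftrightarrow> xl K < fst z \<and> fst z < xr K \<and> yb K < snd z \<and> snd z < yt K"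
proof -
  have "interior K = box (xl K, yb K) (xr K, yt K)"
    by (rule trans[OF arg_cong[OF cell_cbox[OF assms], of interior] interior_cbox])
  then show ?thesis by (cases z) (auto simp: mem_box Basis_prod_def)
qed

text \<open>
  If a point of the edge lay in \<open>\<Omega>\<close>, then so would a point of the open edge. Near that point there is
  no other cell, so a neighbourhood of it would be covered by the cell alone and the point would be
  interior to the cell.
\<close>

lemma boundary_edgeI:
  assumes K: "K \<in> \<G>" and e: "closed_segment a b edge_of K" and ab: "a \<noteq> b"
    and off: "closed_segment a b \<inter> interior K = {}"
    and alone: "\<And>K' z. K' \<in> \<G> \<Longrightarrow> K' \<noteq> K \<Longrightarrow> z \<in> open_segment a b \<Longrightarrow> z \<notin> K'"
  shows "closed_segment a b \<in> boundary_edges \<Omega> \<G>"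
proof -
  have "closed_segment a b \<inter> \<Omega> = {}"
  proof (rule ccontr)
    assume "closed_segment a b \<inter> \<Omega> \<noteq> {}"
    then have "open_segment a b \<inter> \<Omega> \<noteq> {}"
      using open_Int_closure_eq_empty[OF open_\<Omega>, of "open_segment a b"] ab by (auto simp: Int_commute)
    then obtain z where z: "z \<in> open_segment a b" "z \<in> \<Omega>" by blast
    let ?U = "\<Omega> - \<Union>(\<G> - {K})"
    have "open ?U" using finite_\<G> closed_cell by (intro open_Diff open_\<Omega> closed_Union) auto
    moreover have "?U \<subseteq> K" using Union_\<G> closure_subset[of \<Omega>] by blast
    moreover have "z \<in> ?U" using z alone by blast
    ultimately have "z \<in> interior K" by (meson interiorI)
    then show False using off z(1) segment_open_subset_closed by blast
  qed
  moreover have "closed_segment a b \<subseteq> closure \<Omega>"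
    using edge_of_imp_subset[OF e] K Union_\<G> by blast
  ultimately have "closed_segment a b \<subseteq> frontier \<Omega>"
    unfolding frontier_def interior_open[OF open_\<Omega>] by blast
  then show ?thesis using e K unfolding boundary_edges_def grid_edges_def by blast
qed

lemma side_without_nbr:
  assumes K: "K \<in> \<G>"
  shows "\<forall>K'\<in>\<G>. \<not> right_nbr K K' \<Longrightarrow> closed_segment (xr K, yb K) (xr K, yt K) \<in> boundary_edges \<Omega> \<G>"
    and "\<forall>K'\<in>\<G>. \<not> right_nbr K' K \<Longrightarrow> closed_segment (xl K, yb K) (xl K, yt K) \<in> boundary_edges \<Omega> \<G>"
    and "\<forall>K'\<in>\<G>. \<not> upper_nbr K K' \<Longrightarrow> closed_segment (xl K, yt K) (xr K, yt K) \<in> boundary_edges \<Omega> \<G>"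
    and "\<forall>K'\<in>\<G>. \<not> upper_nbr K' K \<Longrightarrow> closed_segment (xl K, yb K) (xr K, yb K) \<in> boundary_edges \<Omega> \<G>"
proof -
  note b = cell_bounds[OF K]
  have le: "xl K \<le> xr K" "yb K \<le> yt K" using b by auto
  have V: "z \<in> K" "fst z = x" "yb K < snd z" "snd z < yt K"
    if "x = xl K \<or> x = xr K" "z \<in> open_segment (x, yb K) (x, yt K)" for x z
    using that b K by (auto simp: open_segment_def closed_segment_axis(1)[OF le(2)] mem_cell)
  have H: "z \<in> K" "snd z = y" "xl K < fst z" "fst z < xr K"
    if "y = yb K \<or> y = yt K" "z \<in> open_segment (xl K, y) (xr K, y)" for y z
    using that b K by (auto simp: open_segment_def closed_segment_axis(2)[OF le(1)] mem_cell)
  have off: "closed_segment (x, yb K) (x, yt K) \<inter> interior K = {}" if "x = xl K \<or> x = xr K" for x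
    using that K by (auto simp: closed_segment_axis(1)[OF le(2)] interior_cell)
  have off': "closed_segment (xl K, y) (xr K, y) \<inter> interior K = {}" if "y = yb K \<or> y = yt K" for y
    using that K by (auto simp: closed_segment_axis(2)[OF le(1)] interior_cell)
  show "closed_segment (xr K, yb K) (xr K, yt K) \<in> boundary_edges \<Omega> \<G>" if "\<forall>K'\<in>\<G>. \<not> right_nbr K K'"
    by (rule boundary_edgeI[OF K sides_edge_of(2)[OF K]])
      (use b off that cell_across_side(1)[OF K] V[of "xr K"] in \<open>simp; metis\<close>)+
  show "closed_segment (xl K, yb K) (xl K, yt K) \<in> boundary_edges \<Omega> \<G>" if "\<forall>K'\<in>\<G>. \<not> right_nbr K' K"
    by (rule boundary_edgeI[OF K sides_edge_of(1)[OF K]])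
      (use b off that cell_across_side(2)[OF K] V[of "xl K"] in \<open>simp; metis\<close>)+
  show "closed_segment (xl K, yt K) (xr K, yt K) \<in> boundary_edges \<Omega> \<G>" if "\<forall>K'\<in>\<G>. \<not> upper_nbr K K'"
    by (rule boundary_edgeI[OF K sides_edge_of(4)[OF K]])
      (use b off' that cell_across_side(3)[OF K] H[of "yt K"] in \<open>simp; metis\<close>)+
  show "closed_segment (xl K, yb K) (xr K, yb K) \<in> boundary_edges \<Omega> \<G>" if "\<forall>K'\<in>\<G>. \<not> upper_nbr K' K"
    by (rule boundary_edgeI[OF K sides_edge_of(3)[OF K]])
      (use b off' that cell_across_side(4)[OF K] H[of "yb K"] in \<open>simp; metis\<close>)+
qed

lemma right_nbr_open_side:
  assumes "K \<in> \<G>" "K' \<in> \<G>" "right_nbr K K'"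
  shows "open_segment (xr K, yb K) (xr K, yt K) \<subseteq> \<Omega>"
proof
  fix z assume z: "z \<in> open_segment (xr K, yb K) (xr K, yt K)"
  have "yb K \<le> yt K" using cell_bounds[OF assms(1)] by simp
  from z have "z = (xr K, snd z)" "yb K < snd z" "snd z < yt K"
    unfolding open_segment_def closed_segment_axis(1)[OF \<open>yb K \<le> yt K\<close>] by (cases z; force)+
  then show "z \<in> \<Omega>" using right_nbr_open_edge[OF assms] by metis
qed

lemma upper_nbr_open_side:
  assumes "K \<in> \<G>" "K' \<in> \<G>" "upper_nbr K K'"
  shows "open_segment (xl K, yt K) (xr K, yt K) \<subseteq> \<Omega>"
proof
  fix z assume z: "z \<in> open_segment (xl K, yt K) (xr K, yt K)"
  have "xl K \<le> xr K" using cell_bounds[OF assms(1)] by simp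
  from z have "z = (fst z, yt K)" "xl K < fst z" "fst z < xr K"
    unfolding open_segment_def closed_segment_axis(2)[OF \<open>xl K \<le> xr K\<close>] by (cases z; force)+
  then show "z \<in> \<Omega>" using upper_nbr_open_edge[OF assms] by metis
qed

lemma side_midpoints:
  "midpoint (xl K, yb K) (xl K, yt K) = midL K" "midpoint (xr K, yb K) (xr K, yt K) = midR K"
  "midpoint (xl K, yb K) (xr K, yb K) = midB K" "midpoint (xl K, yt K) (xr K, yt K) = midT K"
  by (simp_all add: midpoint_def midL_def midR_def midB_def midT_def)

end

section \<open>Balanced edge functions\<close>

lemma simultaneous_integer_approximation:
  fixes g :: "'a \<Rightarrow> real"
  assumes "finite M" "N > 0"
  obtains q :: int and p :: "'a \<Rightarrow> int" where "q > 0" "\<And>m. m \<in> M \<Longrightarrow> \<bar>of_int q * g m - of_int (p m)\<bar> < 1 / real N"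
proof -
  obtain n f where f: "M = f ` {i::nat. i < n}"  "inj_on f {i. i < n}"
    using finite_imp_nat_seg_image_inj_on[OF assms(1)] by blast
  obtain q p where qp: "0 < q" "\<And>i. i < n \<Longrightarrow> \<bar>of_int q * g (f i) - of_int (p i)\<bar> < 1 / real N"
    using Dirichlet_approx_simult[OF assms(2), of n "\<lambda>i. g (f i)"] by blast
  show ?thesis
  proof (rule that[OF qp(1), of "\<lambda>m. p (inv_into {i. i < n} f m)"])
    fix m assume "m \<in> M"
    then obtain i where "i < n" "m = f i" using f by blast
    then show "\<bar>of_int q * g m - of_int (p (inv_into {i. i < n} f m))\<bar> < 1 / real N"
      using qp(2)[of i] f(2) by simp
  qed
qed

text \<open>
  Used with \<open>N\<close> the relation between a cell and its right (or upper) neighbour: a sum of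
  contributions from right edges equals the sum of the contributions from left edges, because
  interior edges are counted once in each and boundary edges contribute zero.
\<close>

lemma sum_over_matching:
  fixes a b :: "'a \<Rightarrow> real"
  assumes "finite S"
    and match: "\<And>x y. x \<in> S \<Longrightarrow> y \<in> S \<Longrightarrow> N x y \<Longrightarrow> a x = b y"
    and uniqr: "\<And>x y y'. x \<in> S \<Longrightarrow> y \<in> S \<Longrightarrow> y' \<in> S \<Longrightarrow> N x y \<Longrightarrow> N x y' \<Longrightarrow> y = y'"
    and uniql: "\<And>x x' y. x \<in> S \<Longrightarrow> x' \<in> S \<Longrightarrow> y \<in> S \<Longrightarrow> N x y \<Longrightarrow> N x' y \<Longrightarrow> x = x'"
    and a0: "\<And>x. x \<in> S \<Longrightarrow> \<forall>y\<in>S. \<not> N x y \<Longrightarrow> a x = 0"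
    and b0: "\<And>y. y \<in> S \<Longrightarrow> \<forall>x\<in>S. \<not> N x y \<Longrightarrow> b y = 0"
  shows "sum a S = sum b S"
proof -
  have "a x = (\<Sum>y\<in>S. if N x y then b y else 0)" if x: "x \<in> S" for x
  proof (cases "\<exists>y\<in>S. N x y")
    case True
    then obtain y where y: "y \<in> S" "N x y" by blast
    have "N x z \<longleftrightarrow> z = y" if "z \<in> S" for z
      using uniqr[OF x that y(1) _ y(2)] y(2) by blast
    then have "(\<Sum>z\<in>S. if N x z then b z else 0) = (\<Sum>z\<in>S. if z = y then b z else 0)"
      by (intro sum.cong) auto
    then show ?thesis using match[OF x y] y \<open>finite S\<close> by simp
  next
    case False
    then show ?thesis using a0[OF x] by (auto intro!: sum.neutral[symmetric])
  qed
  then have "sum a S = (\<Sum>x\<in>S. \<Sum>y\<in>S. if N x y then b y else 0)" by simp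
  also have "\<dots> = (\<Sum>y\<in>S. \<Sum>x\<in>S. if N x y then b y else 0)" by (rule sum.swap)
  also have "\<dots> = sum b S"
  proof (rule sum.cong[OF refl])
    fix y assume y: "y \<in> S"
    show "(\<Sum>x\<in>S. if N x y then b y else 0) = b y"
    proof (cases "\<exists>x\<in>S. N x y")
      case True
      then obtain x where x: "x \<in> S" "N x y" by blast
      have "N z y \<longleftrightarrow> z = x" if "z \<in> S" for z
        using uniql[OF that x(1) y _ x(2)] x(2) by blast
      then have "(\<Sum>z\<in>S. if N z y then b y else 0) = (\<Sum>z\<in>S. if z = x then b y else 0)"
        by (intro sum.cong) auto
      then show ?thesis using x \<open>finite S\<close> by simp
    next
      case False
      then show ?thesis using b0[OF y] by (auto intro!: sum.neutral)
    qed
  qed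
  finally show ?thesis .
qed

text \<open>
  The compatibility of four edge values with an affine function on the cell: both sums are twice
  its value at the centre.
\<close>

definition balanced :: "plane set set \<Rightarrow> (plane \<Rightarrow> real) \<Rightarrow> bool" where
  "balanced \<G> g \<longleftrightarrow> (\<forall>K\<in>\<G>. g (midL K) + g (midR K) = g (midB K) + g (midT K))"

text \<open>
  A side of a cell counts as a boundary edge if no cell lies across it; that such a side is a
  boundary edge of the domain is a separate geometric fact.
\<close>

definition zero_on_boundary :: "plane set set \<Rightarrow> (plane \<Rightarrow> real) \<Rightarrow> bool" where
  "zero_on_boundary \<G> h \<longleftrightarrow> (\<forall>K\<in>\<G>.
     ((\<forall>K'\<in>\<G>. \<not> right_nbr K K') \<longrightarrow> h (midR K) = 0) \<and>
     ((\<forall>K'\<in>\<G>. \<not> right_nbr K' K) \<longrightarrow> h (midL K) = 0) \<and>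
     ((\<forall>K'\<in>\<G>. \<not> upper_nbr K K') \<longrightarrow> h (midT K) = 0) \<and>
     ((\<forall>K'\<in>\<G>. \<not> upper_nbr K' K) \<longrightarrow> h (midB K) = 0))"

text \<open>
  For affine \<open>g\<close> and \<open>h\<close> this is the integral of the Jacobian \<open>g\<^sub>x h\<^sub>y - g\<^sub>y h\<^sub>x\<close> over the cell.
\<close>

definition wedge :: "plane set \<Rightarrow> (plane \<Rightarrow> real) \<Rightarrow> (plane \<Rightarrow> real) \<Rightarrow> real" where
  "wedge K g h = (g (midR K) - g (midL K)) * (h (midT K) - h (midB K))
     - (g (midT K) - g (midB K)) * (h (midR K) - h (midL K))"

lemma midR_eq_midL: "right_nbr K K' \<Longrightarrow> midR K = midL K'"
  by (simp add: right_nbr_def midR_def midL_def)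

lemma midT_eq_midB: "upper_nbr K K' \<Longrightarrow> midT K = midB K'"
  by (simp add: upper_nbr_def midT_def midB_def)

context rect_grid
begin

text \<open>
  A potential of \<open>g\<close> assigns numbers to the corners of each cell so that the value of \<open>g\<close> on an edge
  is the sum of the numbers at its two ends, and so that neighbouring cells agree at the ends of
  their common edge. In a single cell the number \<open>t\<close> at the lower left corner determines the others:
  \<open>g\<^sub>B - t\<close> at the lower right, \<open>g\<^sub>L - t\<close> at the upper left and \<open>t + g\<^sub>R - g\<^sub>B\<close> at the upper right corner,
  the top edge being right by balance. Only \<open>t\<close> is recorded here, with the agreement between
  neighbours as a condition on it. Corner values belong to a cell and not to a point, because at a
  boundary vertex where \<open>\<Omega>\<close> touches itself they need not be single-valued.
\<close>

definition potential :: "(plane \<Rightarrow> real) \<Rightarrow> (plane set \<Rightarrow> real) \<Rightarrow> bool" where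
  "potential g t \<longleftrightarrow> (\<forall>K\<in>\<G>. \<forall>K'\<in>\<G>.
     (right_nbr K K' \<longrightarrow> t K + t K' = g (midB K)) \<and> (upper_nbr K K' \<longrightarrow> t K + t K' = g (midL K)))"

text \<open>
  With a potential the cell term becomes minus twice a discrete boundary integral of \<open>h\<close> against
  the differential of the potential: every edge contributes the value of \<open>h\<close> times the difference
  of the potential between its ends, with opposite signs in the two cells that share it.
\<close>

lemma sum_wedge_potential:
  assumes g: "balanced \<G> g" and h: "balanced \<G> h" "zero_on_boundary \<G> h" and t: "potential g t"
  shows "(\<Sum>K\<in>\<G>. wedge K g h) = 0"
proof -
  (* value of h times the increment, upwards or to the right, of the corner numbers along the edge *)
  define R where "R K = h (midR K) * (2 * t K + g (midR K) - 2 * g (midB K))" for K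
  define L where "L K = h (midL K) * (g (midL K) - 2 * t K)" for K
  define T where "T K = h (midT K) * (2 * t K + g (midR K) - g (midB K) - g (midL K))" for K
  define B where "B K = h (midB K) * (g (midB K) - 2 * t K)" for K
  have w: "wedge K g h = 2 * (L K - R K) + 2 * (T K - B K)" if "K \<in> \<G>" for K
  proof -
    have 1: "g (midT K) = g (midL K) + g (midR K) - g (midB K)"
      and 2: "h (midT K) = h (midL K) + h (midR K) - h (midB K)"
      using g h that unfolding balanced_def by force+
    show ?thesis unfolding wedge_def L_def R_def T_def B_def 1 2 by (simp add: algebra_simps)
  qed
  have RL: "sum R \<G> = sum L \<G>"
  proof (rule sum_over_matching[OF finite_\<G>, where N = right_nbr])
    fix K K' assume K: "K \<in> \<G>" "K' \<in> \<G>" and n: "right_nbr K K'"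
    have e: "g (midB K) = t K + t K'" using t K n unfolding potential_def by force
    show "R K = L K'" unfolding R_def L_def midR_eq_midL[OF n] e by (simp add: algebra_simps)
  next
    fix K K' K'' assume "K \<in> \<G>" "K' \<in> \<G>" "K'' \<in> \<G>" "right_nbr K K'" "right_nbr K K''"
    then show "K' = K''" by (rule right_nbr_unique)
  next
    fix K' K'' K assume "K' \<in> \<G>" "K'' \<in> \<G>" "K \<in> \<G>" "right_nbr K' K" "right_nbr K'' K"
    then show "K' = K''" by (intro left_nbr_unique[of K])
  qed (use h(2) in \<open>simp_all add: zero_on_boundary_def R_def L_def\<close>)
  have TB: "sum T \<G> = sum B \<G>"
  proof (rule sum_over_matching[OF finite_\<G>, where N = upper_nbr])
    fix K K' assume K: "K \<in> \<G>" "K' \<in> \<G>" and n: "upper_nbr K K'"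
    have e: "g (midL K) = t K + t K'" using t K n unfolding potential_def by force
    have b: "g (midR K) = g (midB K) + g (midB K') - g (midL K)"
      using g K midT_eq_midB[OF n] unfolding balanced_def by force
    show "T K = B K'" unfolding T_def B_def midT_eq_midB[OF n] b e by (simp add: algebra_simps)
  next
    fix K K' K'' assume "K \<in> \<G>" "K' \<in> \<G>" "K'' \<in> \<G>" "upper_nbr K K'" "upper_nbr K K''"
    then show "K' = K''" by (rule upper_nbr_unique)
  next
    fix K' K'' K assume "K' \<in> \<G>" "K'' \<in> \<G>" "K \<in> \<G>" "upper_nbr K' K" "upper_nbr K'' K"
    then show "K' = K''" by (intro lower_nbr_unique[of K])
  qed (use h(2) in \<open>simp_all add: zero_on_boundary_def T_def B_def\<close>)
  have "(\<Sum>K\<in>\<G>. wedge K g h) = (\<Sum>K\<in>\<G>. 2 * (L K - R K) + 2 * (T K - B K))"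
    using w by (rule sum.cong[OF refl])
  also have "\<dots> = 2 * (sum L \<G> - sum R \<G>) + 2 * (sum T \<G> - sum B \<G>)"
    by (simp only: sum.distrib sum_subtractf sum_distrib_left[symmetric])
  finally show ?thesis using RL TB by simp
qed

lemma mid_in_cell: "K \<in> \<G> \<Longrightarrow> midL K \<in> K" "K \<in> \<G> \<Longrightarrow> midR K \<in> K" "K \<in> \<G> \<Longrightarrow> midB K \<in> K" "K \<in> \<G> \<Longrightarrow> midT K \<in> K"
  using cell_bounds[of K] by (auto simp: mem_cell midL_def midR_def midB_def midT_def)

lemma cell_coords_mid:
  assumes "K \<in> \<G>"
  shows "cell_fst K (midL K) = 0" "cell_fst K (midR K) = 1" "cell_fst K (midB K) = 1 / 2"
    "cell_fst K (midT K) = 1 / 2" "cell_snd K (midB K) = 0" "cell_snd K (midT K) = 1"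
    "cell_snd K (midL K) = 1 / 2" "cell_snd K (midR K) = 1 / 2"
  using cell_bounds[OF assms]
  by (auto simp: cell_fst_def cell_snd_def midL_def midR_def midB_def midT_def field_simps)

lemma continuous_on_cell_coords [continuous_intros]:
  "K \<in> \<G> \<Longrightarrow> continuous_on S (cell_fst K)" "K \<in> \<G> \<Longrightarrow> continuous_on S (cell_snd K)"
  using cell_bounds[of K] unfolding cell_fst_def cell_snd_def by (auto intro!: continuous_intros)

lemma right_nbr_mid:
  assumes "K \<in> \<G>" "K' \<in> \<G>" "right_nbr K K'"
  shows "midR K \<in> K" "midR K \<in> K'" "midR K \<in> \<Omega>"
proof -
  show "midR K \<in> K" by (rule mid_in_cell(2)[OF assms(1)])
  show "midR K \<in> K'" unfolding midR_eq_midL[OF assms(3)] by (rule mid_in_cell(1)[OF assms(2)])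
  show "midR K \<in> \<Omega>"
    unfolding midR_def using cell_bounds[OF assms(1)] by (intro right_nbr_open_edge[OF assms]) auto
qed

lemma upper_nbr_mid:
  assumes "K \<in> \<G>" "K' \<in> \<G>" "upper_nbr K K'"
  shows "midT K \<in> K" "midT K \<in> K'" "midT K \<in> \<Omega>"
proof -
  show "midT K \<in> K" by (rule mid_in_cell(4)[OF assms(1)])
  show "midT K \<in> K'" unfolding midT_eq_midB[OF assms(3)] by (rule mid_in_cell(3)[OF assms(2)])
  show "midT K \<in> \<Omega>"
    unfolding midT_def using cell_bounds[OF assms(1)] by (intro upper_nbr_open_edge[OF assms]) auto
qed

text \<open>
  By conformity integrality has to be
  checked only along edges shared by neighbours and at corners, and one point of each shared edge,
  its midpoint, suffices to compare the resulting integers.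
\<close>

lemma cell_functions_patch:
  fixes \<rho> :: "plane set \<Rightarrow> plane \<Rightarrow> real"
  assumes sc: "simply_connected \<Omega>" and cont: "\<And>K. K \<in> \<G> \<Longrightarrow> continuous_on K (\<rho> K)"
    and right: "\<And>K K' z. K \<in> \<G> \<Longrightarrow> K' \<in> \<G> \<Longrightarrow> right_nbr K K' \<Longrightarrow> cell_fst K z = 1 \<Longrightarrow> cell_fst K' z = 0
      \<Longrightarrow> cell_snd K z = cell_snd K' z \<Longrightarrow> \<rho> K z - \<rho> K' z \<in> \<int>"
    and upper: "\<And>K K' z. K \<in> \<G> \<Longrightarrow> K' \<in> \<G> \<Longrightarrow> upper_nbr K K' \<Longrightarrow> cell_snd K z = 1 \<Longrightarrow> cell_snd K' z = 0
      \<Longrightarrow> cell_fst K z = cell_fst K' z \<Longrightarrow> \<rho> K z - \<rho> K' z \<in> \<int>"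
    and corner: "\<And>K z. K \<in> \<G> \<Longrightarrow> cell_fst K z \<in> {0, 1} \<Longrightarrow> cell_snd K z \<in> {0, 1} \<Longrightarrow> \<rho> K z \<in> \<int>"
  obtains k :: "plane set \<Rightarrow> int" where
    "\<And>K K'. K \<in> \<G> \<Longrightarrow> K' \<in> \<G> \<Longrightarrow> right_nbr K K' \<Longrightarrow>
       of_int (k K) + \<rho> K (midR K) = of_int (k K') + \<rho> K' (midL K')"
    "\<And>K K'. K \<in> \<G> \<Longrightarrow> K' \<in> \<G> \<Longrightarrow> upper_nbr K K' \<Longrightarrow>
       of_int (k K) + \<rho> K (midT K) = of_int (k K') + \<rho> K' (midB K')"
proof -
  obtain k :: "plane set \<Rightarrow> int" where k:
    "\<And>K K' z. K \<in> \<G> \<Longrightarrow> K' \<in> \<G> \<Longrightarrow> z \<in> K \<Longrightarrow> z \<in> K' \<Longrightarrow> z \<in> \<Omega> \<Longrightarrow>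
       of_int (k K) + \<rho> K z = of_int (k K') + \<rho> K' z"
  proof (rule integer_cocycle_trivial[OF open_\<Omega> sc finite_\<G>])
    show "\<Omega> \<subseteq> \<Union>\<G>" unfolding Union_\<G> by (rule closure_subset)
    show "closed K" if "K \<in> \<G>" for K by (rule closed_cell[OF that])
    show "connected (K \<inter> \<Omega>)" if "K \<in> \<G>" for K by (rule connected_cell_Int[OF that])
    show "continuous_on K (\<rho> K)" if "K \<in> \<G>" for K by (rule cont[OF that])
    fix K K' z assume K: "K \<in> \<G>" "K' \<in> \<G>" and z: "z \<in> K" "z \<in> K'"
    note flip = Ints_minus[of "\<rho> K' z - \<rho> K z", simplified]
    show "\<rho> K z - \<rho> K' z \<in> \<int>"
      by (rule cells_meet_cases[OF K z])
        (use right[OF K, of z] right[OF K(2,1), of z] upper[OF K, of z] upper[OF K(2,1), of z]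
          corner[OF K(1), of z] corner[OF K(2), of z] flip in \<open>auto\<close>)
  qed blast
  show ?thesis
  proof (rule that)
    fix K K' assume a: "K \<in> \<G>" "K' \<in> \<G>" "right_nbr K K'"
    show "of_int (k K) + \<rho> K (midR K) = of_int (k K') + \<rho> K' (midL K')"
      using k[OF a(1,2) right_nbr_mid[OF a]] midR_eq_midL[OF a(3)] by simp
  next
    fix K K' assume a: "K \<in> \<G>" "K' \<in> \<G>" "upper_nbr K K'"
    show "of_int (k K) + \<rho> K (midT K) = of_int (k K') + \<rho> K' (midB K')"
      using k[OF a(1,2) upper_nbr_mid[OF a]] midT_eq_midB[OF a(3)] by simp
  qed
qed

text \<open>
  The sum of the two cell coordinates jumps by one on passing to the right or upper neighbour. The
  integers that compensate these jumps number the diagonals of the grid, and their parity is a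
  global checkerboard colouring. Around a hole such a colouring need not exist.
\<close>

lemma checkerboard_sign:
  assumes "simply_connected \<Omega>"
  obtains \<epsilon> :: "plane set \<Rightarrow> real" where "\<And>K. \<epsilon> K * \<epsilon> K = 1" "\<And>K. \<epsilon> K \<in> \<int>"
    "\<And>K K'. K \<in> \<G> \<Longrightarrow> K' \<in> \<G> \<Longrightarrow> right_nbr K K' \<or> upper_nbr K K' \<Longrightarrow> \<epsilon> K' = - \<epsilon> K"
proof -
  obtain k :: "plane set \<Rightarrow> int" where k:
    "\<And>K K'. K \<in> \<G> \<Longrightarrow> K' \<in> \<G> \<Longrightarrow> right_nbr K K' \<Longrightarrow>
       of_int (k K) + (cell_fst K (midR K) + cell_snd K (midR K))
         = of_int (k K') + (cell_fst K' (midL K') + cell_snd K' (midL K'))"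
    "\<And>K K'. K \<in> \<G> \<Longrightarrow> K' \<in> \<G> \<Longrightarrow> upper_nbr K K' \<Longrightarrow>
       of_int (k K) + (cell_fst K (midT K) + cell_snd K (midT K))
         = of_int (k K') + (cell_fst K' (midB K') + cell_snd K' (midB K'))"
    by (rule cell_functions_patch[OF assms, of "\<lambda>K z. cell_fst K z + cell_snd K z"])
      (auto intro!: continuous_intros)
  have step: "k K' = k K + 1" if "K \<in> \<G>" "K' \<in> \<G>" "right_nbr K K' \<or> upper_nbr K K'" for K K'
    using k[OF that(1,2)] that(3) cell_coords_mid[OF that(1)] cell_coords_mid[OF that(2)] by auto
  show ?thesis
  proof (rule that[of "\<lambda>K. if even (k K) then 1 else - 1"])
    fix K K' assume "K \<in> \<G>" "K' \<in> \<G>" "right_nbr K K' \<or> upper_nbr K K'"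
    from step[OF this] show "(if even (k K') then 1 else - 1) = - (if even (k K) then 1 else - 1 :: real)"
      by auto
  qed auto
qed

text \<open>
  Multiplied by the sign that alternates between the two ends of every edge, the equation
  "sum over the two ends equals \<open>g\<close>" turns into an equation for differences. Its solutions on a
  single cell differ by constants, integers if \<open>g\<close> is integer-valued, so they patch together as
  soon as they are interpolated to continuous functions on the cells.
\<close>

lemma integer_potential_exists:
  assumes sc: "simply_connected \<Omega>" and g: "balanced \<G> g" and int: "\<And>m. g m \<in> \<int>"
  obtains t where "potential g t"
proof -
  obtain \<epsilon> :: "plane set \<Rightarrow> real" where \<epsilon>: "\<And>K. \<epsilon> K * \<epsilon> K = 1" "\<And>K. \<epsilon> K \<in> \<int>"
    "\<And>K K'. K \<in> \<G> \<Longrightarrow> K' \<in> \<G> \<Longrightarrow> right_nbr K K' \<or> upper_nbr K K' \<Longrightarrow> \<epsilon> K' = - \<epsilon> K"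
    by (rule checkerboard_sign[OF sc]) (rule that)
  (* bilinear interpolation of the signed corner numbers of the local potential with t = 0:
     0, - g_B, - g_L and g_R - g_B, times the colour of the cell *)
  define \<rho> where "\<rho> K z = \<epsilon> K * ((g (midR K) + g (midL K)) * (cell_fst K z * cell_snd K z)
      - g (midB K) * cell_fst K z - g (midL K) * cell_snd K z)" for K z
  obtain k :: "plane set \<Rightarrow> int" where k:
    "\<And>K K'. K \<in> \<G> \<Longrightarrow> K' \<in> \<G> \<Longrightarrow> right_nbr K K' \<Longrightarrow>
       of_int (k K) + \<rho> K (midR K) = of_int (k K') + \<rho> K' (midL K')"
    "\<And>K K'. K \<in> \<G> \<Longrightarrow> K' \<in> \<G> \<Longrightarrow> upper_nbr K K' \<Longrightarrow>
       of_int (k K) + \<rho> K (midT K) = of_int (k K') + \<rho> K' (midB K')"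
  proof (rule cell_functions_patch[OF sc])
    show "continuous_on K (\<rho> K)" if "K \<in> \<G>" for K
      unfolding \<rho>_def by (intro continuous_intros that)
  next
    fix K K' z assume K: "K \<in> \<G>" "K' \<in> \<G>" and n: "right_nbr K K'"
      and z: "cell_fst K z = 1" "cell_fst K' z = 0" "cell_snd K z = cell_snd K' z"
    have "\<epsilon> K' = - \<epsilon> K" using \<epsilon>(3) K n by blast
    then have "\<rho> K z - \<rho> K' z = - (\<epsilon> K * g (midB K))"
      unfolding \<rho>_def z midR_eq_midL[OF n] by (simp add: algebra_simps)
    then show "\<rho> K z - \<rho> K' z \<in> \<int>" using \<epsilon>(2) int by simp
  next
    fix K K' z assume K: "K \<in> \<G>" "K' \<in> \<G>" and n: "upper_nbr K K'"
      and z: "cell_snd K z = 1" "cell_snd K' z = 0" "cell_fst K z = cell_fst K' z"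
    have "g (midR K) + g (midL K) = g (midB K) + g (midB K')"
      using g K midT_eq_midB[OF n] unfolding balanced_def by force
    moreover have "\<epsilon> K' = - \<epsilon> K" using \<epsilon>(3) K n by blast
    ultimately have "\<rho> K z - \<rho> K' z = - (\<epsilon> K * g (midL K))"
      unfolding \<rho>_def z by (simp add: algebra_simps)
    then show "\<rho> K z - \<rho> K' z \<in> \<int>" using \<epsilon>(2) int by simp
  next
    fix K z assume "K \<in> \<G>" "cell_fst K z \<in> {0, 1}" "cell_snd K z \<in> {0, 1}"
    then have "cell_fst K z \<in> \<int>" "cell_snd K z \<in> \<int>" by auto
    then show "\<rho> K z \<in> \<int>" unfolding \<rho>_def using int \<epsilon>(2) by simp
  qed blast
  have "potential g (\<lambda>K. \<epsilon> K * of_int (k K))"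
    unfolding potential_def
  proof (intro ballI conjI impI)
    fix K K' assume K: "K \<in> \<G>" "K' \<in> \<G>" and n: "right_nbr K K'"
    have e: "\<epsilon> K' = - \<epsilon> K" using \<epsilon>(3) K n by blast
    have "of_int (k K) - of_int (k K') = \<epsilon> K * g (midB K)"
      using k(1)[OF K n] unfolding \<rho>_def cell_coords_mid[OF K(1)] cell_coords_mid[OF K(2)]
      unfolding e midR_eq_midL[OF n] by (simp add: algebra_simps)
    then have "\<epsilon> K * (of_int (k K) - of_int (k K')) = g (midB K)"
      using \<epsilon>(1)[of K] by (simp add: mult.assoc[symmetric])
    then show "\<epsilon> K * of_int (k K) + \<epsilon> K' * of_int (k K') = g (midB K)"
      unfolding e by (simp add: algebra_simps)
  next
    fix K K' assume K: "K \<in> \<G>" "K' \<in> \<G>" and n: "upper_nbr K K'"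
    have e: "\<epsilon> K' = - \<epsilon> K" using \<epsilon>(3) K n by blast
    have b: "g (midR K) = g (midB K) + g (midB K') - g (midL K)"
      using g K midT_eq_midB[OF n] unfolding balanced_def by force
    have "of_int (k K) - of_int (k K') = \<epsilon> K * g (midL K)"
      using k(2)[OF K n] unfolding \<rho>_def cell_coords_mid[OF K(1)] cell_coords_mid[OF K(2)]
      unfolding e b
      by (simp add: algebra_simps)
    then have "\<epsilon> K * (of_int (k K) - of_int (k K')) = g (midL K)"
      using \<epsilon>(1)[of K] by (simp add: mult.assoc[symmetric])
    then show "\<epsilon> K * of_int (k K) + \<epsilon> K' * of_int (k K') = g (midL K)"
      unfolding e by (simp add: algebra_simps)
  qed
  then show ?thesis by (rule that)
qed

text \<open>
  Real edge functions are reduced to integer ones by simultaneous Diophantine approximation: some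
  multiple \<open>q g\<close> is uniformly close to an integer function \<open>p\<close>. The balance defects of \<open>p\<close> are
  integers and smaller than one in absolute value, so \<open>p\<close> is balanced exactly. Hence \<open>p\<close> contributes
  zero, and the sum for \<open>g\<close>, which is linear in \<open>g\<close>, is as small as the approximation error.
\<close>

lemma sum_wedge_eq_0:
  assumes sc: "simply_connected \<Omega>" and g: "balanced \<G> g"
    and h: "balanced \<G> h" "zero_on_boundary \<G> h"
  shows "(\<Sum>K\<in>\<G>. wedge K g h) = 0"
proof -
  define M where "M = (\<Union>K\<in>\<G>. {midL K, midR K, midB K, midT K})"
  define C where "C = (\<Sum>K\<in>\<G>. 2 * (\<bar>h (midT K) - h (midB K)\<bar> + \<bar>h (midR K) - h (midL K)\<bar>))"
  (* the bound 4 makes the four errors at the edges of a cell add up to less than 1 *)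
  have bound: "\<bar>\<Sum>K\<in>\<G>. wedge K g h\<bar> \<le> C / real N" if N: "N \<ge> 4" for N :: nat
  proof -
    have "finite M" unfolding M_def using finite_\<G> by simp
    then obtain q :: int and p :: "plane \<Rightarrow> int" where q: "q > 0"
      and p: "\<And>m. m \<in> M \<Longrightarrow> \<bar>of_int q * g m - of_int (p m)\<bar> < 1 / real N"
      using simultaneous_integer_approximation[of M N g] N by auto
    define r where "r m = of_int q * g m - of_int (p m)" for m
    have r: "\<bar>r (midL K)\<bar> < 1 / real N" "\<bar>r (midR K)\<bar> < 1 / real N"
      "\<bar>r (midB K)\<bar> < 1 / real N" "\<bar>r (midT K)\<bar> < 1 / real N" if "K \<in> \<G>" for K
      using p that unfolding r_def M_def by blast+
    have "balanced \<G> (\<lambda>m. of_int (p m))"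
      unfolding balanced_def
    proof
      fix K assume K: "K \<in> \<G>"
      have "of_int (p (midL K) + p (midR K) - p (midB K) - p (midT K))
          = of_int q * (g (midL K) + g (midR K) - g (midB K) - g (midT K))
            - (r (midL K) + r (midR K) - r (midB K) - r (midT K))"
        by (simp add: r_def algebra_simps)
      also have "\<dots> = - (r (midL K) + r (midR K) - r (midB K) - r (midT K))"
        using g K unfolding balanced_def by simp
      finally have e: "of_int (p (midL K) + p (midR K) - p (midB K) - p (midT K))
          = - (r (midL K) + r (midR K) - r (midB K) - r (midT K))" .
      have "1 / real N \<le> 1 / 4" using N by (simp add: field_simps)
      then have "\<bar>real_of_int (p (midL K) + p (midR K) - p (midB K) - p (midT K))\<bar> < 1"
        unfolding e using r[OF K] by linarith
      then have "p (midL K) + p (midR K) - p (midB K) - p (midT K) = 0" by linarith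
      then show "real_of_int (p (midL K)) + of_int (p (midR K)) = of_int (p (midB K)) + of_int (p (midT K))"
        by linarith
    qed
    then have p0: "(\<Sum>K\<in>\<G>. wedge K (\<lambda>m. of_int (p m)) h) = 0"
      using integer_potential_exists[OF sc] sum_wedge_potential[OF _ h] by (metis Ints_of_int)
    have "of_int q * (\<Sum>K\<in>\<G>. wedge K g h)
        = (\<Sum>K\<in>\<G>. wedge K (\<lambda>m. of_int (p m)) h + wedge K r h)"
      unfolding sum_distrib_left by (rule sum.cong[OF refl]) (simp add: wedge_def r_def algebra_simps)
    also have "\<dots> = (\<Sum>K\<in>\<G>. wedge K r h)" unfolding sum.distrib p0 by simp
    finally have eq: "of_int q * (\<Sum>K\<in>\<G>. wedge K g h) = (\<Sum>K\<in>\<G>. wedge K r h)" .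
    have "\<bar>\<Sum>K\<in>\<G>. wedge K g h\<bar> \<le> of_int q * \<bar>\<Sum>K\<in>\<G>. wedge K g h\<bar>"
      using mult_right_mono[of 1 "of_int q" "\<bar>\<Sum>K\<in>\<G>. wedge K g h\<bar>"] q by simp
    also have "\<dots> = \<bar>\<Sum>K\<in>\<G>. wedge K r h\<bar>" unfolding eq[symmetric] using q by (simp add: abs_mult)
    also have "\<dots> \<le> (\<Sum>K\<in>\<G>. 2 * (\<bar>h (midT K) - h (midB K)\<bar> + \<bar>h (midR K) - h (midL K)\<bar>) / real N)"
    proof (rule order_trans[OF sum_abs sum_mono])
      fix K assume K: "K \<in> \<G>"
      have a: "\<bar>r (midR K) - r (midL K)\<bar> \<le> 2 / real N" "\<bar>r (midT K) - r (midB K)\<bar> \<le> 2 / real N"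
        using r[OF K] by (auto simp: abs_le_iff)
      have "\<bar>wedge K r h\<bar> \<le> \<bar>r (midR K) - r (midL K)\<bar> * \<bar>h (midT K) - h (midB K)\<bar>
          + \<bar>r (midT K) - r (midB K)\<bar> * \<bar>h (midR K) - h (midL K)\<bar>"
        unfolding wedge_def abs_mult[symmetric] by (rule abs_triangle_ineq4)
      also have "\<dots> \<le> 2 / real N * \<bar>h (midT K) - h (midB K)\<bar> + 2 / real N * \<bar>h (midR K) - h (midL K)\<bar>"
        using a by (intro add_mono mult_right_mono) auto
      finally show "\<bar>wedge K r h\<bar> \<le> 2 * (\<bar>h (midT K) - h (midB K)\<bar> + \<bar>h (midR K) - h (midL K)\<bar>) / real N"
        by (simp add: add_divide_distrib algebra_simps)
    qed
    also have "\<dots> = C / real N" unfolding C_def by (simp add: sum_divide_distrib)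
    finally show ?thesis .
  qed
  have "(\<lambda>N. C / real N) \<longlonglongrightarrow> 0" by real_asymp
  then have "\<bar>\<Sum>K\<in>\<G>. wedge K g h\<bar> \<le> 0"
    by (rule tendsto_lowerbound) (use bound in \<open>auto simp: eventually_sequentially\<close>)
  then show ?thesis by simp
qed

end

section \<open>Quadratic polynomials\<close>

definition quad :: "real \<Rightarrow> real \<Rightarrow> real \<Rightarrow> real \<Rightarrow> real \<Rightarrow> real \<Rightarrow> plane \<Rightarrow> real" where
  "quad c0 c1 c2 c3 c4 c5 z =
     c0 + c1 * fst z + c2 * snd z + c3 * (fst z)\<^sup>2 + c4 * fst z * snd z + c5 * (snd z)\<^sup>2"

lemma P2_quad:
  assumes "p \<in> P2" obtains c0 c1 c2 c3 c4 c5 where "p = quad c0 c1 c2 c3 c4 c5"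
proof -
  obtain c0 c1 c2 c3 c4 c5 where
    "\<And>x y. p (x, y) = c0 + c1 * x + c2 * y + c3 * x\<^sup>2 + c4 * x * y + c5 * y\<^sup>2"
    using assms unfolding P2_def by blast
  then have "p = quad c0 c1 c2 c3 c4 c5" by (auto simp: quad_def fun_eq_iff)
  then show ?thesis by (rule that)
qed

lemma dir_deriv_quad:
  "dir_deriv d (quad c0 c1 c2 c3 c4 c5) =
     quad (fst d * c1 + snd d * c2) (2 * c3 * fst d + c4 * snd d) (c4 * fst d + 2 * c5 * snd d) 0 0 0"
proof
  fix z
  have "(quad c0 c1 c2 c3 c4 c5 has_derivative
      (\<lambda>d. quad (fst d * c1 + snd d * c2) (2 * c3 * fst d + c4 * snd d) (c4 * fst d + 2 * c5 * snd d) 0 0 0 z)) (at z)"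
    unfolding quad_def power2_eq_square
    by (rule has_derivative_eq_rhs, (rule derivative_intros)+, rule ext) (simp add: algebra_simps)
  from fun_cong[OF frechet_derivative_at[OF this], of d]
  show "dir_deriv d (quad c0 c1 c2 c3 c4 c5) z =
    quad (fst d * c1 + snd d * c2) (2 * c3 * fst d + c4 * snd d) (c4 * fst d + 2 * c5 * snd d) 0 0 0 z"
    unfolding dir_deriv_def by (rule sym)
qed

lemma P2_dir_deriv_linear:
  assumes "p \<in> P2"
  shows "dir_deriv (a *\<^sub>R d + b *\<^sub>R e) p z = a * dir_deriv d p z + b * dir_deriv e p z"
proof -
  obtain c0 c1 c2 c3 c4 c5 where "p = quad c0 c1 c2 c3 c4 c5" using P2_quad[OF assms] .
  then show ?thesis by (simp add: dir_deriv_quad) (simp add: quad_def algebra_simps)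
qed

text \<open>
  The midpoint rule is exact for the derivative of a quadratic polynomial along a segment. Hence
  vertex values determine the tangential derivative at the midpoint of an edge.
\<close>

lemma P2_dir_deriv_midpoint:
  assumes "p \<in> P2"
  shows "dir_deriv (b - a) p (midpoint a b) = p b - p a"
proof -
  obtain c0 c1 c2 c3 c4 c5 where "p = quad c0 c1 c2 c3 c4 c5" using P2_quad[OF assms] .
  then show ?thesis
    by (simp add: dir_deriv_quad) (simp add: quad_def midpoint_def algebra_simps power2_eq_square)
qed

text \<open>
  The end points chosen inside \<open>edge_mean\<close> are the given ones up to order, so the midpoint is the
  same.
\<close>

lemma edge_mean_affine:
  assumes "a \<noteq> b"
  shows "edge_mean (closed_segment a b) (quad c0 c1 c2 0 0 0) = quad c0 c1 c2 0 0 0 (midpoint a b)"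
proof -
  let ?f = "quad c0 c1 c2 0 0 0"
  define P where "P = (SOME (p, q). closed_segment a b = closed_segment p q)"
  have "case P of (p, q) \<Rightarrow> closed_segment a b = closed_segment p q"
    unfolding P_def by (rule someI[of _ "(a, b)"]) simp
  then obtain p q where P: "P = (p, q)" and "closed_segment a b = closed_segment p q"
    by (cases P) auto
  then have pq: "{a, b} = {p, q}" by simp
  then have ne: "dist p q \<noteq> 0" using assms by auto
  have mid: "midpoint a b = midpoint p q"
    using pq by (auto simp: doubleton_eq_iff midpoint_sym)
  have "((\<lambda>t. (?f p + t * (?f q - ?f p)) * dist p q) has_integral
      (?f p + 1 / 2 * (?f q - ?f p)) * dist p q) {0..1}"
  proof -
    have "((\<lambda>t. (?f p + t * (?f q - ?f p)) * dist p q) has_integral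
      ((?f p * 1 + 1\<^sup>2 / 2 * (?f q - ?f p)) * dist p q) - ((?f p * 0 + 0\<^sup>2 / 2 * (?f q - ?f p)) * dist p q)) {0..1}"
      by (rule fundamental_theorem_of_calculus[where f = "\<lambda>t. (?f p * t + t\<^sup>2 / 2 * (?f q - ?f p)) * dist p q"])
        (auto intro!: derivative_eq_intros simp: has_real_derivative_iff_has_vector_derivative[symmetric])
    then show ?thesis by simp
  qed
  moreover have "?f (linepath p q t) = ?f p + t * (?f q - ?f p)" for t
    by (simp add: quad_def linepath_def algebra_simps)
  ultimately have "integral {0..1} (\<lambda>t. ?f (linepath p q t) * dist p q)
      = (?f p + 1 / 2 * (?f q - ?f p)) * dist p q"
    by (simp only: integral_unique)
  moreover have "edge_mean (closed_segment a b) ?f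
      = 1 / dist p q * integral {0..1} (\<lambda>t. ?f (linepath p q t) * dist p q)"
    unfolding edge_mean_def P_def[symmetric] P by simp
  ultimately have "edge_mean (closed_segment a b) ?f = ?f p + 1 / 2 * (?f q - ?f p)" using ne by simp
  also have "\<dots> = ?f (midpoint p q)" by (simp add: quad_def midpoint_def algebra_simps)
  finally show ?thesis using mid by simp
qed

lemma edge_mean_dir_deriv_P2:
  assumes "p \<in> P2" "a \<noteq> b"
  shows "edge_mean (closed_segment a b) (dir_deriv d p) = dir_deriv d p (midpoint a b)"
proof -
  obtain c0 c1 c2 c3 c4 c5 where "p = quad c0 c1 c2 c3 c4 c5" using P2_quad[OF assms(1)] .
  then show ?thesis by (simp add: dir_deriv_quad edge_mean_affine[OF assms(2)])
qed

lemma plane_normal_decomposition: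
  fixes n \<tau> d :: plane
  assumes "norm n = 1" "n \<bullet> \<tau> = 0" "\<tau> \<noteq> 0"
  obtains \<alpha> \<beta> where "d = \<alpha> *\<^sub>R n + \<beta> *\<^sub>R \<tau>"
proof -
  obtain n1 n2 t1 t2 d1 d2 where e: "n = (n1, n2)" "\<tau> = (t1, t2)" "d = (d1, d2)"
    by (cases n, cases \<tau>, cases d)
  have n: "n1 * n1 + n2 * n2 = 1" and nt: "n1 * t1 + n2 * t2 = 0"
    using assms by (auto simp: e norm_eq_1)
  define s where "s = t1 * t1 + t2 * t2"
  have s: "s \<noteq> 0" using assms(3) by (auto simp: e s_def sum_squares_eq_zero_iff zero_prod_def)
  (* Lagrange identity: D is the determinant of n and t, so D^2 = |n|^2 |t|^2 - (n . t)^2 *)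
  define D where "D = n1 * t2 - n2 * t1"
  have "D * D = (n1 * n1 + n2 * n2) * s - (n1 * t1 + n2 * t2) * (n1 * t1 + n2 * t2)"
    unfolding D_def s_def by (simp add: algebra_simps)
  then have "D * D = s" using n nt by simp
  then have D: "D \<noteq> 0" using s by auto
  have *: "d1 * D = (d1 * t2 - d2 * t1) * n1 + (n1 * d2 - n2 * d1) * t1"
    "d2 * D = (d1 * t2 - d2 * t1) * n2 + (n1 * d2 - n2 * d1) * t2"
    unfolding D_def by (simp_all add: algebra_simps)
  then have "d = ((d1 * t2 - d2 * t1) / D) *\<^sub>R n + ((n1 * d2 - n2 * d1) / D) *\<^sub>R \<tau>"
    using iffD2[OF nonzero_eq_divide_eq[OF D] *(1)] iffD2[OF nonzero_eq_divide_eq[OF D] *(2)]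
    by (simp add: e add_divide_distrib)
  then show ?thesis by (rule that)
qed

text \<open>
  The degrees of freedom attached to an edge, two vertex values and the mean normal derivative,
  determine the full gradient of a quadratic polynomial at the midpoint of the edge: the mean is the
  midpoint value, and the vertex values give the tangential component.
\<close>

lemma P2_dir_deriv_eqI:
  assumes P2: "p \<in> P2" "q \<in> P2" and n: "norm n = 1" "n \<bullet> (b - a) = 0" "a \<noteq> b"
    and "p a = q a" "p b = q b"
    and "edge_mean (closed_segment a b) (dir_deriv n p) = edge_mean (closed_segment a b) (dir_deriv n q)"
  shows "dir_deriv d p (midpoint a b) = dir_deriv d q (midpoint a b)"
proof -
  obtain \<alpha> \<beta> where d: "d = \<alpha> *\<^sub>R n + \<beta> *\<^sub>R (b - a)"
    by (rule plane_normal_decomposition[of n "b - a" d]) (use n in auto)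
  show ?thesis
    using assms(6-8) unfolding d P2_dir_deriv_linear[OF P2(1)] P2_dir_deriv_linear[OF P2(2)]
      P2_dir_deriv_midpoint[OF P2(1)] P2_dir_deriv_midpoint[OF P2(2)]
      edge_mean_dir_deriv_P2[OF P2(1) n(3)] edge_mean_dir_deriv_P2[OF P2(2) n(3)]
    by simp
qed

lemma zero_in_P2: "(\<lambda>z. 0) \<in> P2"
  unfolding P2_def by (intro CollectI exI[of _ 0]) simp

lemma dir_deriv_zero: "dir_deriv d (\<lambda>z. 0) = (\<lambda>z. 0)"
  by (simp add: dir_deriv_def fun_eq_iff)

lemma laplacian_quad: "laplacian (quad c0 c1 c2 c3 c4 c5) z = 2 * c3 + 2 * c5"
  by (simp add: laplacian_def dir_deriv_quad Basis_prod_def) (simp add: quad_def)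

lemma hessian_inner_quad:
  "hessian_inner (quad c0 c1 c2 c3 c4 c5) (quad d0 d1 d2 d3 d4 d5) z
     = 4 * c3 * d3 + 2 * c4 * d4 + 4 * c5 * d5"
  by (simp add: hessian_inner_def dir_deriv_quad Basis_prod_def) (simp add: quad_def)

section \<open>Edge derivatives of the finite element functions\<close>

lemma V_h0_R_D:
  assumes "w \<in> V_h0_R \<Omega> \<G> n"
  shows "\<And>K. K \<in> \<G> \<Longrightarrow> \<exists>p\<in>P2. AE x in lebesgue_on K. w x = p x"
    and "\<And>a K K'. a \<in> interior_vertices \<Omega> \<G> \<Longrightarrow> K \<in> \<G> \<Longrightarrow> K' \<in> \<G> \<Longrightarrow> a \<in> K \<Longrightarrow> a \<in> K' \<Longrightarrow>
      cell_poly w K a = cell_poly w K' a"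
    and "\<And>e K K'. e \<in> interior_edges \<Omega> \<G> \<Longrightarrow> K \<in> \<G> \<Longrightarrow> K' \<in> \<G> \<Longrightarrow> e edge_of K \<Longrightarrow> e edge_of K' \<Longrightarrow>
      edge_mean e (dir_deriv (n e) (cell_poly w K)) = edge_mean e (dir_deriv (n e) (cell_poly w K'))"
    and "\<And>a K. a \<in> boundary_vertices \<Omega> \<G> \<Longrightarrow> K \<in> \<G> \<Longrightarrow> a \<in> K \<Longrightarrow> cell_poly w K a = 0"
    and "\<And>e K. e \<in> boundary_edges \<Omega> \<G> \<Longrightarrow> K \<in> \<G> \<Longrightarrow> e edge_of K \<Longrightarrow>
      edge_mean e (dir_deriv (n e) (cell_poly w K)) = 0"
  using assms unfolding V_h0_R_def mem_Collect_eq by (elim conjE; meson)+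

context rect_grid
begin

lemma cell_poly_P2:
  assumes "w \<in> V_h0_R \<Omega> \<G> n" "K \<in> \<G>" shows "cell_poly w K \<in> P2"
proof -
  obtain p where p: "p \<in> P2" "AE x in lebesgue_on K. w x = p x"
    using V_h0_R_D(1)[OF assms] by blast
  have "box (xl K, yb K) (xr K, yt K) \<noteq> {}"
    using cell_bounds[OF assms(2)] by (auto simp: box_ne_empty Basis_prod_def)
  moreover have "AE x in lebesgue_on (cbox (xl K, yb K) (xr K, yt K)). w x = p x"
    by (rule iffD1[OF arg_cong[OF cell_cbox[OF assms(2)], of "\<lambda>S. AE x in lebesgue_on S. w x = p x"] p(2)])
  ultimately have "cell_poly w (cbox (xl K, yb K) (xr K, yt K)) = p"
    by (rule cell_poly_eqI[OF p(1)])
  then have "cell_poly w K = p" by (rule trans[OF arg_cong[OF cell_cbox[OF assms(2)]]])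
  then show ?thesis using p(1) by simp
qed

lemma edge_endpoints:
  assumes "K \<in> \<G>" "closed_segment a b edge_of K"
  shows "a \<in> K" "b \<in> K" "a \<in> grid_vertices \<G>" "b \<in> grid_vertices \<G>"
proof -
  have "a extreme_point_of K" "b extreme_point_of K"
    using assms(2) extreme_point_of_face[of "closed_segment a b" K a]
      extreme_point_of_face[of "closed_segment a b" K b]
    unfolding edge_of_def by (simp_all add: extreme_point_of_segment)
  then show "a \<in> K" "b \<in> K" "a \<in> grid_vertices \<G>" "b \<in> grid_vertices \<G>"
    using assms(1) by (auto simp: extreme_point_of_def grid_vertices_def)
qed

text \<open>
  At vertices on the boundary of the domain continuity across cells comes from the boundary
  condition. This covers interior edges that end on the boundary.
\<close>

lemma cell_poly_vertex_eq:
  assumes w: "w \<in> V_h0_R \<Omega> \<G> n" and K: "K \<in> \<G>" "K' \<in> \<G>" and a: "a \<in> grid_vertices \<G>" "a \<in> K" "a \<in> K'"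
  shows "cell_poly w K a = cell_poly w K' a"
proof (cases "a \<in> \<Omega>")
  case True
  then show ?thesis using a K by (intro V_h0_R_D(2)[OF w]) (auto simp: interior_vertices_def)
next
  case False
  then have "a \<in> boundary_vertices \<Omega> \<G>"
    using a K Union_\<G> unfolding boundary_vertices_def frontier_def interior_open[OF open_\<Omega>] by blast
  then show ?thesis using V_h0_R_D(4)[OF w _ K(1)] V_h0_R_D(4)[OF w _ K(2)] a by simp
qed

lemma gradient_continuous_at_interior_edge:
  assumes w: "w \<in> V_h0_R \<Omega> \<G> n" and n: "unit_normals \<G> n" and K: "K \<in> \<G>" "K' \<in> \<G>" and ab: "a \<noteq> b"
    and e: "closed_segment a b edge_of K" "closed_segment a b edge_of K'" "open_segment a b \<subseteq> \<Omega>"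
  shows "dir_deriv d (cell_poly w K) (midpoint a b) = dir_deriv d (cell_poly w K') (midpoint a b)"
proof (rule P2_dir_deriv_eqI[OF cell_poly_P2[OF w K(1)] cell_poly_P2[OF w K(2)], where n = "n (closed_segment a b)"])
  have ge: "closed_segment a b \<in> grid_edges \<G>" using K e unfolding grid_edges_def by blast
  show "norm (n (closed_segment a b)) = 1" "n (closed_segment a b) \<bullet> (b - a) = 0"
    using n ge unfolding unit_normals_def by auto
  show "a \<noteq> b" by fact
  note v = edge_endpoints[OF K(1) e(1)] edge_endpoints[OF K(2) e(2)]
  show "cell_poly w K a = cell_poly w K' a" "cell_poly w K b = cell_poly w K' b"
    using v by (auto intro: cell_poly_vertex_eq[OF w K])
  have "closed_segment a b \<in> interior_edges \<Omega> \<G>"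
    using ge e ab unfolding interior_edges_def by (simp add: rel_interior_closed_segment)
  then show "edge_mean (closed_segment a b) (dir_deriv (n (closed_segment a b)) (cell_poly w K))
      = edge_mean (closed_segment a b) (dir_deriv (n (closed_segment a b)) (cell_poly w K'))"
    using K e by (intro V_h0_R_D(3)[OF w])
qed

lemma gradient_zero_at_boundary_edge:
  assumes w: "w \<in> V_h0_R \<Omega> \<G> n" and n: "unit_normals \<G> n" and K: "K \<in> \<G>" and ab: "a \<noteq> b"
    and e: "closed_segment a b edge_of K" "closed_segment a b \<in> boundary_edges \<Omega> \<G>"
  shows "dir_deriv d (cell_poly w K) (midpoint a b) = 0"
proof -
  have "dir_deriv d (cell_poly w K) (midpoint a b) = dir_deriv d (\<lambda>z. 0) (midpoint a b)"
  proof (rule P2_dir_deriv_eqI[OF cell_poly_P2[OF w K] zero_in_P2, where n = "n (closed_segment a b)"])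
    have ge: "closed_segment a b \<in> grid_edges \<G>" using K e unfolding grid_edges_def by blast
    show "norm (n (closed_segment a b)) = 1" "n (closed_segment a b) \<bullet> (b - a) = 0"
      using n ge unfolding unit_normals_def by auto
    show "a \<noteq> b" by fact
    have "a \<in> frontier \<Omega>" "b \<in> frontier \<Omega>" using e(2) unfolding boundary_edges_def by auto
    then have "a \<in> boundary_vertices \<Omega> \<G>" "b \<in> boundary_vertices \<Omega> \<G>"
      using edge_endpoints[OF K e(1)] unfolding boundary_vertices_def by auto
    then show "cell_poly w K a = 0" "cell_poly w K b = 0"
      using edge_endpoints[OF K e(1)] by (auto intro: V_h0_R_D(4)[OF w _ K])
    have "edge_mean (closed_segment a b) (dir_deriv (n (closed_segment a b)) (cell_poly w K)) = 0"
      by (rule V_h0_R_D(5)[OF w e(2) K e(1)])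
    then show "edge_mean (closed_segment a b) (dir_deriv (n (closed_segment a b)) (cell_poly w K))
        = edge_mean (closed_segment a b) (dir_deriv (n (closed_segment a b)) (\<lambda>z. 0))"
      by (simp add: dir_deriv_zero edge_mean_def split_beta)
  qed
  then show ?thesis by (simp add: dir_deriv_zero)
qed

lemma gradient_across_right:
  assumes w: "w \<in> V_h0_R \<Omega> \<G> n" and n: "unit_normals \<G> n" and K: "K \<in> \<G>" "K' \<in> \<G>" and r: "right_nbr K K'"
  shows "dir_deriv d (cell_poly w K) (midR K) = dir_deriv d (cell_poly w K') (midR K)"
  unfolding side_midpoints(2)[symmetric]
proof (rule gradient_continuous_at_interior_edge[OF w n K _ sides_edge_of(2)[OF K(1)] _ right_nbr_open_side[OF K r]])
  show "(xr K, yb K) \<noteq> (xr K, yt K)" using cell_bounds[OF K(1)] by simp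
  show "closed_segment (xr K, yb K) (xr K, yt K) edge_of K'"
    using sides_edge_of(1)[OF K(2)] r by (simp only: right_nbr_def)
qed

lemma gradient_across_top:
  assumes w: "w \<in> V_h0_R \<Omega> \<G> n" and n: "unit_normals \<G> n" and K: "K \<in> \<G>" "K' \<in> \<G>" and r: "upper_nbr K K'"
  shows "dir_deriv d (cell_poly w K) (midT K) = dir_deriv d (cell_poly w K') (midT K)"
  unfolding side_midpoints(4)[symmetric]
proof (rule gradient_continuous_at_interior_edge[OF w n K _ sides_edge_of(4)[OF K(1)] _ upper_nbr_open_side[OF K r]])
  show "(xl K, yt K) \<noteq> (xr K, yt K)" using cell_bounds[OF K(1)] by simp
  show "closed_segment (xl K, yt K) (xr K, yt K) edge_of K'"
    using sides_edge_of(3)[OF K(2)] r by (simp only: upper_nbr_def)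
qed

lemma gradient_at_shared_midpoint:
  assumes w: "w \<in> V_h0_R \<Omega> \<G> n" and n: "unit_normals \<G> n" and K: "K \<in> \<G>" "K' \<in> \<G>"
    and m: "m \<in> {midL K, midR K, midB K, midT K}" "m \<in> K'"
  shows "dir_deriv d (cell_poly w K') m = dir_deriv d (cell_poly w K) m"
proof (cases "K' = K")
  case False
  have mK: "m \<in> K" using m mid_in_cell[OF K(1)] by auto
  note across = cell_across_side[OF K False mK m(2)]
  note b = cell_bounds[OF K(1)]
  consider "m = midL K" | "m = midR K" | "m = midB K" | "m = midT K" using m by blast
  then show ?thesis
  proof cases
    case 1
    then have r: "right_nbr K' K" using across(2) b by (simp add: midL_def)
    show ?thesis using gradient_across_right[OF w n K(2,1) r] 1 midR_eq_midL[OF r] by simp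
  next
    case 2
    then have r: "right_nbr K K'" using across(1) b by (simp add: midR_def)
    show ?thesis using gradient_across_right[OF w n K r] 2 by simp
  next
    case 3
    then have r: "upper_nbr K' K" using across(4) b by (simp add: midB_def)
    show ?thesis using gradient_across_top[OF w n K(2,1) r] 3 midT_eq_midB[OF r] by simp
  next
    case 4
    then have r: "upper_nbr K K'" using across(3) b by (simp add: midT_def)
    show ?thesis using gradient_across_top[OF w n K r] 4 by simp
  qed
qed simp

text \<open>
  The derivative of a finite element function at the midpoint of an edge. It can be read off from
  any cell that contains the midpoint, by continuity of the gradient there.
\<close>

definition edge_deriv :: "plane \<Rightarrow> (plane \<Rightarrow> real) \<Rightarrow> plane \<Rightarrow> real" where
  "edge_deriv d w m = dir_deriv d (cell_poly w (SOME K. K \<in> \<G> \<and> m \<in> K)) m"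

lemma edge_deriv_eq:
  assumes w: "w \<in> V_h0_R \<Omega> \<G> n" and n: "unit_normals \<G> n" and K: "K \<in> \<G>"
    and m: "m \<in> {midL K, midR K, midB K, midT K}"
  shows "edge_deriv d w m = dir_deriv d (cell_poly w K) m"
proof -
  let ?K = "SOME K. K \<in> \<G> \<and> m \<in> K"
  have "?K \<in> \<G> \<and> m \<in> ?K"
    by (rule someI[of _ K]) (use K m mid_in_cell[OF K] in auto)
  then show ?thesis
    unfolding edge_deriv_def using gradient_at_shared_midpoint[OF w n K _ m] by blast
qed

lemma edge_deriv_balanced:
  assumes w: "w \<in> V_h0_R \<Omega> \<G> n" and n: "unit_normals \<G> n"
  shows "balanced \<G> (edge_deriv d w)"
  unfolding balanced_def
proof
  fix K assume K: "K \<in> \<G>"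
  obtain c0 c1 c2 c3 c4 c5 where p: "cell_poly w K = quad c0 c1 c2 c3 c4 c5"
    using P2_quad[OF cell_poly_P2[OF w K]] .
  have e: "edge_deriv d w m = dir_deriv d (quad c0 c1 c2 c3 c4 c5) m"
    if "m \<in> {midL K, midR K, midB K, midT K}" for m
    using edge_deriv_eq[OF w n K that] p by simp
  show "edge_deriv d w (midL K) + edge_deriv d w (midR K) = edge_deriv d w (midB K) + edge_deriv d w (midT K)"
    by (simp add: e dir_deriv_quad) (simp add: quad_def midL_def midR_def midB_def midT_def algebra_simps)
qed

lemma edge_deriv_zero_on_boundary:
  assumes w: "w \<in> V_h0_R \<Omega> \<G> n" and n: "unit_normals \<G> n"
  shows "zero_on_boundary \<G> (edge_deriv d w)"
  unfolding zero_on_boundary_def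
proof (intro ballI conjI impI)
  fix K assume K: "K \<in> \<G>"
  note zero = gradient_zero_at_boundary_edge[OF w n K _ sides_edge_of(1)[OF K]]
    gradient_zero_at_boundary_edge[OF w n K _ sides_edge_of(2)[OF K]]
    gradient_zero_at_boundary_edge[OF w n K _ sides_edge_of(3)[OF K]]
    gradient_zero_at_boundary_edge[OF w n K _ sides_edge_of(4)[OF K]]
  note zero = zero[unfolded side_midpoints]
  show "edge_deriv d w (midR K) = 0" if "\<forall>K'\<in>\<G>. \<not> right_nbr K K'"
    using zero(2)[OF _ side_without_nbr(1)[OF K that]] cell_bounds[OF K] edge_deriv_eq[OF w n K] by simp
  show "edge_deriv d w (midL K) = 0" if "\<forall>K'\<in>\<G>. \<not> right_nbr K' K"
    using zero(1)[OF _ side_without_nbr(2)[OF K that]] cell_bounds[OF K] edge_deriv_eq[OF w n K] by simp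
  show "edge_deriv d w (midT K) = 0" if "\<forall>K'\<in>\<G>. \<not> upper_nbr K K'"
    using zero(4)[OF _ side_without_nbr(3)[OF K that]] cell_bounds[OF K] edge_deriv_eq[OF w n K] by simp
  show "edge_deriv d w (midB K) = 0" if "\<forall>K'\<in>\<G>. \<not> upper_nbr K' K"
    using zero(3)[OF _ side_without_nbr(4)[OF K that]] cell_bounds[OF K] edge_deriv_eq[OF w n K] by simp
qed

lemma set_lebesgue_integral_cell_const:
  assumes "K \<in> \<G>"
  shows "(LINT x:K|lebesgue. c) = c * ((xr K - xl K) * (yt K - yb K))"
proof -
  have "measure lebesgue (cbox (xl K, yb K) (xr K, yt K)) = (xr K - xl K) * (yt K - yb K)"
    using cell_bounds[OF assms] by (simp add: content_Pair)
  then have "measure lebesgue K = (xr K - xl K) * (yt K - yb K)"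
    by (rule trans[OF arg_cong[OF cell_cbox[OF assms]]])
  then show ?thesis unfolding set_lebesgue_integral_def by simp
qed

text \<open>
  Both integrands are constant on the cell, and their difference is
  \<open>u\<^sub>x\<^sub>x v\<^sub>y\<^sub>y + u\<^sub>y\<^sub>y v\<^sub>x\<^sub>x - 2 u\<^sub>x\<^sub>y v\<^sub>x\<^sub>y\<close>, the Jacobian of \<open>(u\<^sub>x, v\<^sub>y)\<close> minus that of \<open>(u\<^sub>y, v\<^sub>x)\<close>.
\<close>

lemma cell_integral_difference:
  assumes u: "u \<in> V_h0_R \<Omega> \<G> n" and v: "v \<in> V_h0_R \<Omega> \<G> n" and n: "unit_normals \<G> n" and K: "K \<in> \<G>"
  shows "(LINT x:K|lebesgue. laplacian (cell_poly u K) x * laplacian (cell_poly v K) x)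
      - (LINT x:K|lebesgue. hessian_inner (cell_poly u K) (cell_poly v K) x)
    = wedge K (edge_deriv (1, 0) u) (edge_deriv (0, 1) v) - wedge K (edge_deriv (0, 1) u) (edge_deriv (1, 0) v)"
proof -
  obtain c0 c1 c2 c3 c4 c5 where p: "cell_poly u K = quad c0 c1 c2 c3 c4 c5"
    using P2_quad[OF cell_poly_P2[OF u K]] .
  obtain d0 d1 d2 d3 d4 d5 where q: "cell_poly v K = quad d0 d1 d2 d3 d4 d5"
    using P2_quad[OF cell_poly_P2[OF v K]] .
  have e: "edge_deriv d u m = dir_deriv d (quad c0 c1 c2 c3 c4 c5) m"
    "edge_deriv d v m = dir_deriv d (quad d0 d1 d2 d3 d4 d5) m"
    if "m \<in> {midL K, midR K, midB K, midT K}" for m d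
    using edge_deriv_eq[OF u n K that] edge_deriv_eq[OF v n K that] p q by simp_all
  define X Y where "X = xr K - xl K" and "Y = yt K - yb K"
  have incr: "edge_deriv (1, 0) u (midR K) - edge_deriv (1, 0) u (midL K) = 2 * c3 * X"
    "edge_deriv (1, 0) u (midT K) - edge_deriv (1, 0) u (midB K) = c4 * Y"
    "edge_deriv (0, 1) u (midR K) - edge_deriv (0, 1) u (midL K) = c4 * X"
    "edge_deriv (0, 1) u (midT K) - edge_deriv (0, 1) u (midB K) = 2 * c5 * Y"
    "edge_deriv (1, 0) v (midR K) - edge_deriv (1, 0) v (midL K) = 2 * d3 * X"
    "edge_deriv (1, 0) v (midT K) - edge_deriv (1, 0) v (midB K) = d4 * Y"
    "edge_deriv (0, 1) v (midR K) - edge_deriv (0, 1) v (midL K) = d4 * X"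
    "edge_deriv (0, 1) v (midT K) - edge_deriv (0, 1) v (midB K) = 2 * d5 * Y"
    by (simp_all add: e dir_deriv_quad)
      (simp_all add: quad_def midL_def midR_def midB_def midT_def X_def Y_def algebra_simps)
  show ?thesis
    unfolding wedge_def incr p q laplacian_quad hessian_inner_quad
      set_lebesgue_integral_cell_const[OF K] X_def[symmetric] Y_def[symmetric]
    by (simp add: algebra_simps)
qed

end

section \<open>The Laplacian and the Hessian form agree\<close>

theorem lemma3p8:
  fixes \<Omega> :: "plane set" and \<G> :: "plane set set" and n :: "plane set \<Rightarrow> plane"
    and u v :: "plane \<Rightarrow> real"
  assumes "polygonal_domain \<Omega>" and "simply_connected \<Omega>"
    and "rectangular_grid \<Omega> \<G>" and "unit_normals \<G> n"
    and "u \<in> V_h0_R \<Omega> \<G> n" and "v \<in> V_h0_R \<Omega> \<G> n"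
  shows "(\<Sum>K\<in>\<G>. LINT x:K|lebesgue. laplacian (cell_poly u K) x * laplacian (cell_poly v K) x) =
         (\<Sum>K\<in>\<G>. LINT x:K|lebesgue. hessian_inner (cell_poly u K) (cell_poly v K) x)"
proof -
  interpret rect_grid \<Omega> \<G> using assms by unfold_locales
  have zero: "(\<Sum>K\<in>\<G>. wedge K (edge_deriv d u) (edge_deriv d' v)) = 0" for d d'
    using assms by (intro sum_wedge_eq_0 edge_deriv_balanced edge_deriv_zero_on_boundary)
  have "(\<Sum>K\<in>\<G>. LINT x:K|lebesgue. laplacian (cell_poly u K) x * laplacian (cell_poly v K) x)
      - (\<Sum>K\<in>\<G>. LINT x:K|lebesgue. hessian_inner (cell_poly u K) (cell_poly v K) x)
    = (\<Sum>K\<in>\<G>. wedge K (edge_deriv (1, 0) u) (edge_deriv (0, 1) v)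
        - wedge K (edge_deriv (0, 1) u) (edge_deriv (1, 0) v))"
    unfolding sum_subtractf[symmetric] using assms by (intro sum.cong refl cell_integral_difference)
  then show ?thesis unfolding sum_subtractf zero by simp
qed

end
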